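(* Let $U\subset \mathbb R$ be an interval and suppose that $\varphi\in C^{1,1}(U) \cap C^{2,\alpha}_{loc}(U)$ for some $\alpha>0$. Let $u\in \mathscr{S}(\mathbb{R}^{N+1})$ be such that $u(\mathbb R^{N+1})\subset U$. For $s\in(0,1)$ and $(X,t)\in\mathbb R^{N+1}$ one has $$(-\mathscr K)^s \varphi(u(X,t)) = \varphi'(u(X,t)) (-\mathscr K)^s u(X,t) - \varphi''(u(X,t))\, \Gamma^{\mathscr K}_{(s)}(u)(X,t) + \mathscr R^{\mathscr K}_{(s)}(u;\varphi)(X,t),$$ where the remainder $\mathscr R^{\mathscr K}_{(s)}(u;\varphi)(X,t)$ (which is determined by this identity) satisfies, for every $(X,t)\in \mathbb R^{N+1}$, $$\lim_{s\to 1^-} \mathscr R^{\mathscr K}_{(s)}(u;\varphi)(X,t) = 0.$$ When $\varphi(t) = a t^2 + bt + c$ (with $a,b,c\in\mathbb R$), we have $\mathscr R^{\mathscr K}_{(s)}(u;\varphi) \equiv 0$.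
   Context: $N\ge 2$; points of $\mathbb R^{N+1}$ are written $(X,t)$ with $X\in\mathbb R^N$, $t\in\mathbb R$, and $\mathscr S(\mathbb R^{N+1})$ is the Schwartz space (real-valued functions). $C^{1,1}(U)$ denotes the $C^1$ functions on $U$ whose derivative is Lipschitz on $U$ (so that $\varphi''\in L^\infty(U)$ for $\varphi\in C^{1,1}(U)\cap C^2(U)$), and $C^{2,\alpha}_{loc}(U)$ the $C^2$ functions on $U$ whose second derivative is locally $\alpha$-Hölder continuous. Let $Q,B$ be real constant $N\times N$ matrices with $Q=Q^\star\ge 0$, and $$\mathscr K u = \operatorname{tr}(Q \nabla^2 u) + \langle BX,\nabla u\rangle - \partial_t u ,\qquad K(t) = \frac 1t \int_0^t e^{\sigma B} Q e^{\sigma B^\star} d\sigma ,$$ where $\nabla,\nabla^2$ are taken in $X$. It is assumed that $K(t)$ is invertible (i.e. strictly positive) for every $t>0$. Let $$p(X,Y,t) = (4\pi)^{- \frac N2} \left(\det(t K(t))\right)^{-1/2} \exp\left( - \frac{\langle K(t)^{-1}(Y-e^{tB} X ),Y-e^{tB} X \rangle}{4t}\right)$$ for $X,Y\in\mathbb R^N$, $t>0$, and $$P_\tau^{\mathscr K} u(X,t) = \int_{\mathbb R^N} p(X,Y,\tau)\, u(Y,t-\tau)\, dY,\qquad \tau>0.$$ For $s\in(0,1)$ define $$(-\mathscr K)^s w(X,t) = - \frac{s}{\Gamma(1-s)} \int_0^\infty \tau^{-1-s} \left[P^{\mathscr K}_\tau w(X,t)- w(X,t)\right] d\tau ,$$ where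 $\Gamma(\cdot)$ with a numerical argument is the Euler gamma function; this formula is used both for $w=u$ and for $w=\varphi\circ u$, and $(-\mathscr K)^s\varphi(u(X,t))$ means $(-\mathscr K)^s(\varphi\circ u)(X,t)$. The nonlocal evolutive carré du champ of $u:\mathbb R^{N+1}\to\mathbb R$ is $$\Gamma^{\mathscr K}_{(s)}(u)(X,t) = \frac{s}{2\Gamma(1-s)}\int_0^\infty \frac{1}{\tau^{1+s}}\, P^{\mathscr K}_\tau\big((u - u(X,t))^2\big)(X,t)\, d\tau,$$ where $P^{\mathscr K}_\tau((u - u(X,t))^2)(X,t)=\int_{\mathbb R^N}p(X,Y,\tau)\,(u(Y,t-\tau)-u(X,t))^2\,dY$. *)

theory Defs
  imports "HOL-Analysis.Analysis"
begin

section \<open>Function spaces\<close>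

text \<open>Iterated directional derivatives; the head of the list is the outermost derivative.\<close>

primrec iter_deriv :: "'a list \<Rightarrow> ('a::euclidean_space \<Rightarrow> real) \<Rightarrow> 'a \<Rightarrow> real" where
  "iter_deriv [] f = f"
| "iter_deriv (v # vs) f = (\<lambda>x. frechet_derivative (iter_deriv vs f) (at x) v)"

text \<open>The multi-index derivatives are the iterated derivatives along lists of coordinate
  directions. Requiring all of them to be Frechet differentiable says that \<open>f\<close> is smooth.\<close>

definition schwartz :: "('a::euclidean_space \<Rightarrow> real) \<Rightarrow> bool" where
  "schwartz f \<longleftrightarrow>
     (\<forall>vs. set vs \<subseteq> Basis \<longrightarrow>
        iter_deriv vs f differentiable_on UNIV \<and>
        (\<forall>k::nat. \<exists>C. \<forall>x. norm x ^ k * \<bar>iter_deriv vs f x\<bar> \<le> C))"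

text \<open>The derivative is taken relative to \<open>U\<close>, hence one-sided at those endpoints of the
  interval \<open>U\<close> that belong to it. On a one-point \<open>U\<close> its value is unspecified.\<close>

definition deriv_in :: "real set \<Rightarrow> (real \<Rightarrow> real) \<Rightarrow> real \<Rightarrow> real" where
  "deriv_in U f x = vector_derivative f (at x within U)"

definition C1_on :: "real set \<Rightarrow> (real \<Rightarrow> real) \<Rightarrow> bool" where
  "C1_on U f \<longleftrightarrow> f differentiable_on U \<and> continuous_on U (deriv_in U f)"

definition C11_on :: "real set \<Rightarrow> (real \<Rightarrow> real) \<Rightarrow> bool" where
  "C11_on U f \<longleftrightarrow> C1_on U f \<and> (\<exists>L. L-lipschitz_on U (deriv_in U f))"

definition locally_holder_on :: "real \<Rightarrow> real set \<Rightarrow> (real \<Rightarrow> real) \<Rightarrow> bool" where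
  "locally_holder_on \<alpha> U f \<longleftrightarrow>
     (\<forall>x\<in>U. \<exists>\<epsilon>>0. \<exists>C. \<forall>y\<in>U \<inter> ball x \<epsilon>. \<forall>z\<in>U \<inter> ball x \<epsilon>.
        \<bar>f y - f z\<bar> \<le> C * \<bar>y - z\<bar> powr \<alpha>)"

definition C2_loc_holder_on :: "real \<Rightarrow> real set \<Rightarrow> (real \<Rightarrow> real) \<Rightarrow> bool" where
  "C2_loc_holder_on \<alpha> U f \<longleftrightarrow>
     C1_on U f \<and> C1_on U (deriv_in U f) \<and>
     locally_holder_on \<alpha> U (deriv_in U (deriv_in U f))"

section \<open>The Kolmogorov semigroup and its fractional powers\<close>

text \<open>The power series is written out because \<open>exp\<close> is not available for matrices: in the
  library \<open>*\<close> on \<open>real ^ 'n ^ 'n\<close> is entrywise, the matrix product being \<open>**\<close>.\<close>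

definition matrix_exp :: "real ^ 'n ^ 'n \<Rightarrow> real ^ 'n ^ 'n" where
  "matrix_exp A = (\<Sum>k. ((**) A ^^ k) (mat 1) /\<^sub>R fact k)"

definition Kmat :: "real ^ 'n ^ 'n \<Rightarrow> real ^ 'n ^ 'n \<Rightarrow> real \<Rightarrow> real ^ 'n ^ 'n" where
  "Kmat Q B t =
     (1 / t) *\<^sub>R integral {0..t}
       (\<lambda>\<sigma>. matrix_exp (\<sigma> *\<^sub>R B) ** Q ** matrix_exp (\<sigma> *\<^sub>R transpose B))"

definition kernel ::
    "real ^ 'n ^ 'n \<Rightarrow> real ^ 'n ^ 'n \<Rightarrow> real ^ 'n \<Rightarrow> real ^ 'n \<Rightarrow> real \<Rightarrow> real" where
  "kernel Q B X Y t =
     (4 * pi) powr (- (real CARD('n) / 2)) * det (t *\<^sub>R Kmat Q B t) powr (- (1 / 2)) *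
     exp (- (((matrix_inv (Kmat Q B t) *v (Y - matrix_exp (t *\<^sub>R B) *v X)) \<bullet>
              (Y - matrix_exp (t *\<^sub>R B) *v X)) / (4 * t)))"

text \<open>The evolutive semigroup acts on functions of \<open>(X, t)\<close>.\<close>

definition semigroup_P ::
    "real ^ 'n ^ 'n \<Rightarrow> real ^ 'n ^ 'n \<Rightarrow> real \<Rightarrow>
     ((real ^ 'n) \<times> real \<Rightarrow> real) \<Rightarrow> (real ^ 'n) \<times> real \<Rightarrow> real" where
  "semigroup_P Q B \<tau> w = (\<lambda>(X, t). LINT Y|lborel. kernel Q B X Y \<tau> * w (Y, t - \<tau>))"

definition frac_K ::
    "real ^ 'n ^ 'n \<Rightarrow> real ^ 'n ^ 'n \<Rightarrow> real \<Rightarrow>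
     ((real ^ 'n) \<times> real \<Rightarrow> real) \<Rightarrow> (real ^ 'n) \<times> real \<Rightarrow> real" where
  "frac_K Q B s w z =
     - (s / Gamma (1 - s)) *
     (LINT \<tau>:{0<..}|lborel. \<tau> powr (- 1 - s) * (semigroup_P Q B \<tau> w z - w z))"

definition carre_du_champ ::
    "real ^ 'n ^ 'n \<Rightarrow> real ^ 'n ^ 'n \<Rightarrow> real \<Rightarrow>
     ((real ^ 'n) \<times> real \<Rightarrow> real) \<Rightarrow> (real ^ 'n) \<times> real \<Rightarrow> real" where
  "carre_du_champ Q B s u z =
     s / (2 * Gamma (1 - s)) *
     (LINT \<tau>:{0<..}|lborel.
        1 / \<tau> powr (1 + s) * semigroup_P Q B \<tau> (\<lambda>y. (u y - u z)\<^sup>2) z)"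

text \<open>The Bochner integral of a non-integrable function is \<open>0\<close>. The following predicates say
  that all integrals in the preceding definitions converge absolutely, so that the values
  of \<open>frac_K\<close> and \<open>carre_du_champ\<close> are the intended ones.\<close>

definition semigroup_P_converges ::
    "real ^ 'n ^ 'n \<Rightarrow> real ^ 'n ^ 'n \<Rightarrow> ((real ^ 'n) \<times> real \<Rightarrow> real) \<Rightarrow> (real ^ 'n) \<times> real \<Rightarrow> bool" where
  "semigroup_P_converges Q B w = (\<lambda>(X, t).
     \<forall>\<tau>>0. integrable lborel (\<lambda>Y. kernel Q B X Y \<tau> * w (Y, t - \<tau>)))"

definition frac_K_converges ::
    "real ^ 'n ^ 'n \<Rightarrow> real ^ 'n ^ 'n \<Rightarrow> real \<Rightarrow>
     ((real ^ 'n) \<times> real \<Rightarrow> real) \<Rightarrow> (real ^ 'n) \<times> real \<Rightarrow> bool" where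
  "frac_K_converges Q B s w z \<longleftrightarrow>
     semigroup_P_converges Q B w z \<and>
     set_integrable lborel {0<..}
       (\<lambda>\<tau>. \<tau> powr (- 1 - s) * (semigroup_P Q B \<tau> w z - w z))"

definition carre_du_champ_converges ::
    "real ^ 'n ^ 'n \<Rightarrow> real ^ 'n ^ 'n \<Rightarrow> real \<Rightarrow>
     ((real ^ 'n) \<times> real \<Rightarrow> real) \<Rightarrow> (real ^ 'n) \<times> real \<Rightarrow> bool" where
  "carre_du_champ_converges Q B s u z \<longleftrightarrow>
     semigroup_P_converges Q B (\<lambda>y. (u y - u z)\<^sup>2) z \<and>
     set_integrable lborel {0<..}
       (\<lambda>\<tau>. 1 / \<tau> powr (1 + s) * semigroup_P Q B \<tau> (\<lambda>y. (u y - u z)\<^sup>2) z)"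

end

theory Submission
  imports Defs "HOL-Probability.Distributions"
begin

text \<open>Factoring \<open>2 \<tau> K(\<tau>) = A A\<^sup>T\<close> and substituting \<open>Y = m + A Z\<close> with
  \<open>m = e\<^bsup>\<tau>B\<^esup> X\<close> turns \<open>P\<^sub>\<tau> w (X, t)\<close> into the standard Gaussian average of
  \<open>w (m + A Z, t - \<tau>)\<close>, where \<open>\<bar>m - X\<bar> = O(\<tau>)\<close> and \<open>\<bar>A Z\<bar> = O(\<surd>\<tau> \<bar>Z\<bar>)\<close>. Since odd moments vanish,
  \<open>P\<^sub>\<tau> u - u = O(\<tau>)\<close>, while \<open>P\<^sub>\<tau>\<close> maps \<open>\<bar>u - u(z)\<bar>\<^sup>2\<close> to \<open>O(\<tau>)\<close> and \<open>\<bar>u - u(z)\<bar>\<^sup>4\<close> to \<open>O(\<tau>\<^sup>2)\<close> at \<open>z\<close>.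
  The remainder is the fractional power, at \<open>z\<close>, of the second order Taylor remainder \<open>h\<close> of \<open>\<phi>\<close> at
  \<open>u(z)\<close> composed with \<open>u\<close>. For every \<open>\<epsilon> > 0\<close> one has
  \<open>\<bar>h\<bar> \<le> \<epsilon> \<bar>u - u(z)\<bar>\<^sup>2 + C \<bar>u - u(z)\<bar>\<^sup>4\<close>, so \<open>\<bar>P\<^sub>\<tau> h\<bar> \<le> \<epsilon>' \<tau> + C' \<tau>\<^sup>2\<close> near \<open>0\<close>; the
  factor \<open>s / \<Gamma>(1 - s) = s (1 - s) / \<Gamma>(2 - s)\<close> then bounds the limit by \<open>\<epsilon>'\<close>.\<close>

section \<open>Lebesgue measure under linear maps\<close>

text \<open>Two kinds of estimate are needed. For \<open>u\<close> itself a pointwise bound of the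
  increment gives only O(sqrt \<tau>), which against \<open>\<tau> powr (-1 - s)\<close> is not
  integrable at 0 once s \<ge> 1/2; the Gaussian form is made explicit so that the linear term can
  integrate to zero. The other pieces of the identity, the first order Taylor remainder of \<phi>
  and the squared increment of \<open>u\<close>, vanish to second order at \<open>z\<close>, so
  moments suffice. The identity is then linearity of the fractional power, and each piece must be
  shown to converge before it is split off, because a divergent Bochner integral has the value 0.
  For the limit, O(\<tau>) alone is not enough: the integral of \<tau> to the power -s over (0,1] is
  1/(1-s), which exactly cancels the decay of 1/Gamma(1-s). Smallness must sit in the coefficient of
  \<tau>, while the constants of the \<tau>-squared term and of the tail \<tau> \<ge> 1 may be
  arbitrarily large, since their integrals stay bounded as s tends to 1. The Lipschitz bound on the
  derivative controls \<phi> far from \<open>u z\<close>, where differentiability of the derivative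
  at \<open>u z\<close> gives no information.\<close>

lemma nn_integral_lborel_shear:
  fixes h :: "'a::euclidean_space \<Rightarrow> ennreal"
  assumes [measurable]: "h \<in> borel_measurable borel"
    and b: "b \<in> Basis" and c: "c \<in> Basis" and "b \<noteq> c"
  shows "(\<integral>\<^sup>+x. h (x + (x \<bullet> c) *\<^sub>R b) \<partial>lborel) = (\<integral>\<^sup>+x. h x \<partial>lborel)"
proof -
  interpret product_sigma_finite "\<lambda>b::'a. lborel :: real measure" ..
  let ?I = "Basis - {b}"
  let ?s = "\<lambda>g. \<Sum>k\<in>Basis. g k *\<^sub>R (k::'a)"
  let ?M = "\<Pi>\<^sub>M k\<in>?I. (lborel :: real measure)"
  have ins: "insert b ?I = Basis" using b by auto
  have fold: "(\<integral>\<^sup>+x. f x \<partial>lborel) = (\<integral>\<^sup>+g. (\<integral>\<^sup>+y. f (?s (g(b := y))) \<partial>lborel) \<partial>?M)"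
    if [measurable]: "f \<in> borel_measurable borel" for f :: "'a \<Rightarrow> ennreal"
  proof -
    have "(\<integral>\<^sup>+x. f x \<partial>lborel) = (\<integral>\<^sup>+g. f (?s g) \<partial>(\<Pi>\<^sub>M k\<in>insert b ?I. lborel))"
      unfolding ins by (subst lborel_eq, subst nn_integral_distr) auto
    also have "\<dots> = (\<integral>\<^sup>+g. (\<integral>\<^sup>+y. f (?s (g(b := y))) \<partial>lborel) \<partial>?M)"
    proof (subst product_nn_integral_insert)
      have "(\<lambda>g. f (?s g)) \<in> borel_measurable (\<Pi>\<^sub>M k\<in>Basis. lborel)"
        by measurable
      then show "(\<lambda>g. f (?s g)) \<in> borel_measurable (\<Pi>\<^sub>M k\<in>insert b ?I. lborel)"
        unfolding ins .
    qed auto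
    finally show ?thesis .
  qed
  \<comment> \<open>Since c differs from b, the amount \<open>g c\<close> of the shear is constant
    along each line parallel to b. On such a line the shear is a translation, which Lebesgue measure
    does not see. The factor \<open>1 * y\<close> shapes the argument for
    \<open>nn_integral_real_affine\<close>.\<close>
  have shift: "?s (g(b := y)) + (?s (g(b := y)) \<bullet> c) *\<^sub>R b = ?s (g(b := g c + 1 * y))" for g y
  proof -
    have split: "?s (g(b := z)) = z *\<^sub>R b + (\<Sum>k\<in>?I. g k *\<^sub>R k)" for z
      using b by (subst sum.remove[of _ b]) auto
    have "?s (g(b := y)) \<bullet> c = g c"
    proof -
      have "?s (g(b := y)) \<bullet> c = (\<Sum>k\<in>Basis. if k = c then (g(b := y)) c else 0)"
        unfolding inner_sum_left by (intro sum.cong) (auto simp: inner_Basis c)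
      then show ?thesis using c \<open>b \<noteq> c\<close> by simp
    qed
    then show ?thesis unfolding split by (simp add: algebra_simps)
  qed
  have "(\<integral>\<^sup>+x. h (x + (x \<bullet> c) *\<^sub>R b) \<partial>lborel) =
      (\<integral>\<^sup>+g. (\<integral>\<^sup>+y. h (?s (g(b := g c + 1 * y))) \<partial>lborel) \<partial>?M)"
    by (subst fold) (simp_all only: shift, measurable)
  also have "\<dots> = (\<integral>\<^sup>+g. (\<integral>\<^sup>+y. h (?s (g(b := y))) \<partial>lborel) \<partial>?M)"
  proof (rule nn_integral_cong)
    fix g :: "'a \<Rightarrow> real"
    have "(\<lambda>y. ?s (g(b := y))) = (\<lambda>y. y *\<^sub>R b + (\<Sum>k\<in>?I. g k *\<^sub>R k))"
      using b by (subst sum.remove[of _ b]) auto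
    then have [measurable]: "(\<lambda>y. ?s (g(b := y))) \<in> borel_measurable borel"
      by simp
    show "(\<integral>\<^sup>+y. h (?s (g(b := g c + 1 * y))) \<partial>lborel) = (\<integral>\<^sup>+y. h (?s (g(b := y))) \<partial>lborel)"
      by (subst (2) nn_integral_real_affine[where c = 1 and t = "g c"]) simp_all
  qed
  also have "\<dots> = (\<integral>\<^sup>+x. h x \<partial>lborel)"
    by (rule fold[symmetric]) simp
  finally show ?thesis .
qed

text \<open>Lebesgue measure is determined by its values on boxes, and the preimage of a box is the
  box with permuted sides, whose volume is the same product in another order.\<close>

lemma distr_lborel_permute_cart:
  fixes p :: "'n::finite \<Rightarrow> 'n"
  assumes p: "bij p"
  shows "distr lborel borel (\<lambda>x::real^'n. \<chi> i. x $ p i) = lborel"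
proof (rule lborel_eqI[symmetric])
  let ?T = "\<lambda>x::real^'n. \<chi> i. x $ p i"
  let ?S = "\<lambda>x::real^'n. \<chi> i. x $ inv p i"
  fix l u :: "real^'n"
  assume le: "\<And>b. b \<in> Basis \<Longrightarrow> l \<bullet> b \<le> u \<bullet> b"
  have le': "l $ i \<le> u $ i" for i
    using le[of "axis i 1"] by (simp add: inner_axis axis_in_Basis_iff)
  have inv: "p (inv p i) = i" "inv p (p i) = i" for i
    using p by (simp_all add: bij_is_surj bij_is_inj surj_f_inv_f)
  have [measurable]: "?T \<in> borel_measurable borel"
    by (intro borel_measurable_continuous_onI continuous_intros)
  have pre: "?T -` box l u = box (?S l) (?S u)"
    unfolding box_def by (auto simp: Basis_vec_def inner_axis) (metis inv)+
  have prod_cart: "(\<Prod>b\<in>Basis. (y - x) \<bullet> b) = (\<Prod>i\<in>UNIV. y $ i - x $ i)" for x y :: "real^'n"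
  proof -
    have Basis_eq: "(Basis :: (real^'n) set) = (\<lambda>i. axis i 1) ` UNIV"
      by (auto simp: Basis_vec_def)
    show ?thesis unfolding Basis_eq
      by (subst prod.reindex) (auto simp: inj_on_def axis_eq_axis inner_axis)
  qed
  have "emeasure (distr lborel borel ?T) (box l u) = emeasure lborel (box (?S l) (?S u))"
    by (subst emeasure_distr) (simp_all add: pre)
  also have "\<dots> = (\<Prod>i\<in>UNIV. u $ inv p i - l $ inv p i)"
  proof (subst emeasure_lborel_box)
    show "?S l \<bullet> b \<le> ?S u \<bullet> b" if "b \<in> Basis" for b
      using that le' by (auto simp: Basis_vec_def inner_axis)
  qed (simp add: prod_cart)
  also have "(\<Prod>i\<in>UNIV. u $ inv p i - l $ inv p i) = (\<Prod>i\<in>UNIV. u $ i - l $ i)"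
    by (rule prod.reindex_bij_betw) (simp add: p bij_imp_bij_inv)
  finally show "emeasure (distr lborel borel ?T) (box l u) = (\<Prod>b\<in>Basis. (u - l) \<bullet> b)"
    by (simp add: prod_cart)
qed simp


text \<open>Both sides are multiplicative in \<open>A\<close>, so it is enough to treat diagonal
  matrices, swaps and shears. The statement under induction quantifies over all \<open>h\<close>,
  because the product case applies the hypothesis for the right factor to \<open>h\<close> composed
  with the left one. Nonsingularity sits inside it as an implication, since matrices with a zero row
  also occur in the induction. The determinant stands as a factor, which avoids division in
  \<open>ennreal\<close>.\<close>

lemma nn_integral_lborel_matrix:
  fixes A :: "real^'n^'n" and h :: "real^'n \<Rightarrow> ennreal"
  assumes "det A \<noteq> 0" and "h \<in> borel_measurable borel"
  shows "(\<integral>\<^sup>+x. h (A *v x) \<partial>lborel) * ennreal \<bar>det A\<bar> = (\<integral>\<^sup>+x. h x \<partial>lborel)"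
proof -
  let ?P = "\<lambda>A::real^'n^'n. det A \<noteq> 0 \<longrightarrow> (\<forall>h\<in>borel_measurable borel.
     (\<integral>\<^sup>+x. h (A *v x) \<partial>lborel) * ennreal \<bar>det A\<bar> = (\<integral>\<^sup>+x. h x \<partial>lborel))"
  have [measurable]: "(\<lambda>x. A *v x) \<in> borel_measurable borel" for A :: "real^'n^'n"
    by (intro borel_measurable_continuous_onI continuous_intros)
  have "?P A"
  proof (induction A rule: induct_matrix_elementary_alt)
    case (1 A B)
    show ?case
    proof (intro impI ballI)
      fix h :: "real^'n \<Rightarrow> ennreal" assume [measurable]: "h \<in> borel_measurable borel"
      assume "det (A ** B) \<noteq> 0"
      then have nz: "det A \<noteq> 0" "det B \<noteq> 0" by (auto simp: det_mul)
      have "(\<integral>\<^sup>+x. h ((A ** B) *v x) \<partial>lborel) * ennreal \<bar>det (A ** B)\<bar>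
          = (\<integral>\<^sup>+x. h (A *v (B *v x)) \<partial>lborel) * ennreal \<bar>det B\<bar> * ennreal \<bar>det A\<bar>"
        by (simp add: det_mul abs_mult ennreal_mult matrix_vector_mul_assoc ac_simps)
      also have "(\<integral>\<^sup>+x. h (A *v (B *v x)) \<partial>lborel) * ennreal \<bar>det B\<bar> = (\<integral>\<^sup>+x. h (A *v x) \<partial>lborel)"
        using 1(2) nz by (auto dest!: bspec[of _ _ "\<lambda>x. h (A *v x)"])
      also have "\<dots> * ennreal \<bar>det A\<bar> = (\<integral>\<^sup>+x. h x \<partial>lborel)"
        using 1(1) nz by auto
      finally show "(\<integral>\<^sup>+x. h ((A ** B) *v x) \<partial>lborel) * ennreal \<bar>det (A ** B)\<bar> = (\<integral>\<^sup>+x. h x \<partial>lborel)" .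
    qed
  next
    case (2 A i)
    then show ?case by (simp add: det_zero_row)
  next
    case (3 A)
    show ?case
    proof (intro impI ballI)
      fix h :: "real^'n \<Rightarrow> ennreal" assume [measurable]: "h \<in> borel_measurable borel"
      assume nz: "det A \<noteq> 0"
      have det: "det A = (\<Prod>i\<in>UNIV. A $ i $ i)" by (rule det_diagonal) (rule 3)
      define c where "c b = (A *v b) \<bullet> b" for b
      have Basis_eq: "(Basis :: (real^'n) set) = (\<lambda>i. axis i 1) ` UNIV"
        by (auto simp: Basis_vec_def)
      have c_axis: "c (axis i 1) = A $ i $ i" for i
        by (simp add: c_def inner_axis matrix_vector_mult_basis column_def)
      have cnz: "c b \<noteq> 0" if "b \<in> Basis" for b
        using that nz by (auto simp: Basis_eq c_axis det)
      have prod_c: "(\<Prod>b\<in>Basis. c b) = det A"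
        unfolding Basis_eq det
        by (subst prod.reindex) (auto simp: inj_on_def axis_eq_axis c_axis)
      have T: "(\<Sum>b\<in>Basis. (c b * (x \<bullet> b)) *\<^sub>R b) = A *v x" for x
      proof -
        have "(A *v x) $ i = A $ i $ i * x $ i" for i
        proof -
          have "A $ i $ j * x $ j = (if j = i then A $ i $ i * x $ i else 0)" for j
            using 3[of i j] by (cases "i = j") simp_all
          then have "(A *v x) $ i = (\<Sum>j\<in>UNIV. if j = i then A $ i $ i * x $ i else 0)"
            unfolding matrix_vector_mult_def vec_lambda_beta by (rule sum.cong[OF refl])
          then show ?thesis by simp
        qed
        then have "(A *v x) \<bullet> b = c b * (x \<bullet> b)" if "b \<in> Basis" for b
          using that by (auto simp: Basis_eq c_axis inner_axis)
        then have "(\<Sum>b\<in>Basis. (c b * (x \<bullet> b)) *\<^sub>R b) = (\<Sum>b\<in>Basis. ((A *v x) \<bullet> b) *\<^sub>R b)"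
          by simp
        then show ?thesis by (simp only: euclidean_representation)
      qed
      have "(\<integral>\<^sup>+x. h x \<partial>lborel) = (\<integral>\<^sup>+x. h x \<partial>(density (distr lborel borel (\<lambda>x. 0 + (\<Sum>b\<in>Basis. (c b * (x \<bullet> b)) *\<^sub>R b))) (\<lambda>_. (\<Prod>b\<in>Basis. \<bar>c b\<bar>))))"
        by (rule arg_cong[where f = "\<lambda>M. integral\<^sup>N M h"], rule lborel_affine_euclidean) (rule cnz)
      also have "\<dots> = (\<integral>\<^sup>+x. h x \<partial>(density (distr lborel borel (\<lambda>x. A *v x)) (\<lambda>_. \<bar>det A\<bar>)))"
        unfolding T add_0 abs_prod[symmetric] prod_c ..
      also have "\<dots> = (\<integral>\<^sup>+x. h (A *v x) \<partial>lborel) * ennreal \<bar>det A\<bar>"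
        by (simp add: nn_integral_density nn_integral_cmult nn_integral_distr ac_simps)
      finally show "(\<integral>\<^sup>+x. h (A *v x) \<partial>lborel) * ennreal \<bar>det A\<bar> = (\<integral>\<^sup>+x. h x \<partial>lborel)" by simp
    qed
  next
    case (4 m n)
    let ?p = "Transposition.transpose m n"
    let ?S = "\<chi> i j. mat 1 $ i $ ?p j :: real^'n^'n"
    have [simp]: "det ?S = -1"
    proof -
      have "?p permutes UNIV" by (rule permutes_swap_id) auto
      then have "det ?S = of_int (sign ?p) * det (mat 1 :: real^'n^'n)"
        by (rule det_permute_columns)
      then show ?thesis using 4 by (simp add: sign_swap_id det_I)
    qed
    have Sv: "?S *v x = (\<chi> i. x $ ?p i)" for x
    proof -
      have "i = ?p j \<longleftrightarrow> j = ?p i" for i j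
        by (metis transpose_involutory)
      then have "(mat 1 :: real^'n^'n) $ i $ ?p j * x $ j = (if j = ?p i then x $ j else 0)" for i j
        by (simp add: mat_def)
      then show ?thesis by (simp add: vec_eq_iff matrix_vector_mult_def)
    qed
    show ?case
    proof (intro impI ballI)
      fix h :: "real^'n \<Rightarrow> ennreal" assume [measurable]: "h \<in> borel_measurable borel"
      have [measurable]: "(\<lambda>x::real^'n. \<chi> i. x $ ?p i) \<in> borel_measurable borel"
        by (intro borel_measurable_continuous_onI continuous_intros)
      have "(\<integral>\<^sup>+x. h x \<partial>lborel) = (\<integral>\<^sup>+x. h x \<partial>distr lborel borel (\<lambda>x. \<chi> i. x $ ?p i))"
        by (subst distr_lborel_permute_cart) auto
      also have "\<dots> = (\<integral>\<^sup>+x. h (?S *v x) \<partial>lborel)"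
        by (simp add: Sv nn_integral_distr)
      finally show "(\<integral>\<^sup>+x. h (?S *v x) \<partial>lborel) * ennreal \<bar>det ?S\<bar> = (\<integral>\<^sup>+x. h x \<partial>lborel)" by simp
    qed
  next
    case (5 m n)
    let ?S = "\<chi> i j. of_bool (i = m \<and> j = n \<or> i = j) :: real^'n^'n"
    have Sv: "?S *v x = x + (x \<bullet> axis n 1) *\<^sub>R axis m 1" for x
    proof -
      have "?S $ i $ j * x $ j = (if j = i then x $ j else 0) + (if j = n then of_bool (i = m) * x $ j else 0)" for i j
        using 5 by auto
      then have "(?S *v x) $ i = (\<Sum>j\<in>UNIV. (if j = i then x $ j else 0) + (if j = n then of_bool (i = m) * x $ j else 0))" for i
        unfolding matrix_vector_mult_def vec_lambda_beta by (intro sum.cong) simp_all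
      then have "(?S *v x) $ i = x $ i + of_bool (i = m) * x $ n" for i
        by (simp add: sum.distrib)
      moreover have "x \<bullet> axis n 1 = x $ n" by (simp add: inner_axis)
      ultimately show ?thesis by (auto simp: vec_eq_iff axis_def)
    qed
    have "?S = (\<chi> k. if k = m then row m (mat 1) + 1 *s row n (mat 1) else row k (mat 1))"
      using 5 by (auto simp: vec_eq_iff row_def mat_def)
    then have det1: "det ?S = 1"
      by (simp only: det_row_operation[OF 5] det_I)
    show ?case
      unfolding det1 Sv using 5 by (auto simp: nn_integral_lborel_shear axis_in_Basis_iff axis_eq_axis)
  qed
  then show ?thesis using assms by blast
qed

text \<open>As an identity of measures the change of variables also transports integrability and
  integrals of signed functions.\<close>

lemma lborel_eq_density_distr_matrix:
  fixes A :: "real^'n^'n"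
  assumes "det A \<noteq> 0"
  shows "lborel = density (distr lborel borel ((*v) A)) (\<lambda>_. ennreal \<bar>det A\<bar>)"
proof (rule measure_eqI)
  have [measurable]: "(*v) A \<in> borel_measurable borel"
    by (intro borel_measurable_continuous_onI continuous_intros)
  fix S :: "(real^'n) set" assume "S \<in> sets lborel"
  then have [measurable]: "S \<in> sets borel" by simp
  have "emeasure lborel S = (\<integral>\<^sup>+x. indicator S x \<partial>lborel)" by simp
  also have "\<dots> = (\<integral>\<^sup>+x. indicator S (A *v x) \<partial>lborel) * ennreal \<bar>det A\<bar>"
    by (rule nn_integral_lborel_matrix[symmetric]) (use assms in auto)
  also have "\<dots> = emeasure (density (distr lborel borel ((*v) A)) (\<lambda>_. ennreal \<bar>det A\<bar>)) S"
    by (simp add: emeasure_density nn_integral_distr nn_integral_cmult ac_simps)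
  finally show "emeasure lborel S =
    emeasure (density (distr lborel borel ((*v) A)) (\<lambda>_. ennreal \<bar>det A\<bar>)) S" .
qed simp

lemma lborel_affine_matrix:
  fixes A :: "real^'n^'n" and f :: "real^'n \<Rightarrow> real"
  assumes A: "det A \<noteq> 0" and [measurable]: "f \<in> borel_measurable borel"
  shows integrable_affine_matrix:
      "integrable lborel f \<longleftrightarrow> integrable lborel (\<lambda>x. f (m + A *v x))" (is ?int)
    and integral_affine_matrix:
      "(LINT x|lborel. f x) = \<bar>det A\<bar> * (LINT x|lborel. f (m + A *v x))" (is ?eq)
proof -
  have [measurable]: "(*v) A \<in> borel_measurable borel"
    by (intro borel_measurable_continuous_onI continuous_intros)
  have [measurable]: "(\<lambda>x. f (m + x)) \<in> borel_measurable borel"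
    by simp
  have "integrable lborel f \<longleftrightarrow> integrable lborel (\<lambda>x. f (m + x))"
    by (subst lborel_distr_plus[of m, symmetric], subst integrable_distr_eq) auto
  also have "\<dots> \<longleftrightarrow> integrable lborel (\<lambda>x. f (m + A *v x))"
    using A by (subst lborel_eq_density_distr_matrix[OF A])
      (simp add: integrable_density integrable_distr_eq)
  finally show ?int .
  have "(LINT x|lborel. f x) = (LINT x|lborel. f (m + x))"
    by (subst lborel_distr_plus[of m, symmetric], subst integral_distr) auto
  also have "\<dots> = \<bar>det A\<bar> * (LINT x|lborel. f (m + A *v x))"
    by (subst lborel_eq_density_distr_matrix[OF A])
      (simp add: integral_density integral_distr)
  finally show ?eq .
qed

section \<open>The standard Gaussian\<close>

text \<open>The product form lets the total mass factor over coordinates; the closed form in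
  \<open>std_gauss_eq\<close> is the one matched with the kernel.\<close>

definition std_gauss :: "'a::euclidean_space \<Rightarrow> real" where
  "std_gauss x = (\<Prod>b\<in>Basis. std_normal_density (x \<bullet> b))"

lemma std_gauss_measurable [measurable]: "std_gauss \<in> borel_measurable borel"
  unfolding std_gauss_def[abs_def] by measurable

lemma std_gauss_nonneg: "0 \<le> std_gauss x"
  unfolding std_gauss_def by (intro prod_nonneg) auto

lemma std_gauss_uminus: "std_gauss (- x) = std_gauss x"
  unfolding std_gauss_def by (simp add: std_normal_density_def)

lemma std_gauss_eq:
  fixes x :: "'a::euclidean_space"
  shows "std_gauss x = (2 * pi) powr (- (DIM('a) / 2)) * exp (- (x \<bullet> x) / 2)"
proof -
  have "1 / sqrt (2 * pi) = (2 * pi) powr (- (1 / 2))"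
    by (simp add: powr_minus powr_half_sqrt divide_simps)
  then have "(1 / sqrt (2 * pi)) ^ DIM('a) = (2 * pi) powr (- (DIM('a) / 2))"
    by (simp add: powr_powr flip: powr_realpow)
  moreover have "(\<Prod>b\<in>Basis. exp (- (x \<bullet> b)\<^sup>2 / 2)) = exp (- (x \<bullet> x) / 2)"
    by (simp add: euclidean_inner[of x x] power2_eq_square sum_divide_distrib sum_negf flip: exp_sum)
  ultimately show ?thesis
    unfolding std_gauss_def std_normal_density_def prod.distrib by simp
qed

lemma
  shows integrable_std_gauss: "integrable lborel (std_gauss :: 'a::euclidean_space \<Rightarrow> real)"
    and integral_std_gauss: "(LINT x|lborel. std_gauss (x :: 'a)) = 1"
proof -
  have 1: "(\<integral>\<^sup>+x. ennreal (std_normal_density x) \<partial>lborel) = 1"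
    using prob_space.emeasure_space_1[OF prob_space_normal_density[of 1 0]]
    by (simp add: emeasure_density)
  have "(\<integral>\<^sup>+x. ennreal (std_gauss (x::'a)) \<partial>lborel) =
      (\<integral>\<^sup>+x. (\<Prod>b\<in>Basis. ennreal (std_normal_density ((x::'a) \<bullet> b))) \<partial>lborel)"
    unfolding std_gauss_def by (subst prod_ennreal) auto
  also have "\<dots> = 1"
    by (subst nn_integral_lborel_prod[where f = "\<lambda>_ x. ennreal (std_normal_density x)"])
      (auto simp: 1)
  finally have *: "has_bochner_integral lborel (std_gauss :: 'a \<Rightarrow> real) 1"
    by (intro has_bochner_integral_nn_integral) (auto simp: std_gauss_nonneg)
  show "integrable lborel (std_gauss :: 'a \<Rightarrow> real)" "(LINT x|lborel. std_gauss (x :: 'a)) = 1"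
    using * by (auto simp: has_bochner_integral_iff)
qed

lemma integrable_std_gauss_bounded:
  fixes f :: "'a::euclidean_space \<Rightarrow> real"
  assumes [measurable]: "f \<in> borel_measurable borel" and "\<And>x. \<bar>f x\<bar> \<le> M"
  shows "integrable lborel (\<lambda>x. std_gauss x * f x)"
proof (rule Bochner_Integration.integrable_bound)
  show "integrable lborel (\<lambda>x::'a. M * std_gauss x)"
    by (intro integrable_mult_right integrable_std_gauss)
  show "AE x in lborel. norm (std_gauss x * f x) \<le> norm (M * std_gauss x)"
  proof (rule AE_I2)
    fix x :: 'a
    have "\<bar>f x\<bar> \<le> \<bar>M\<bar>" using assms(2)[of x] by linarith
    then show "norm (std_gauss x * f x) \<le> norm (M * std_gauss x)"
      using mult_left_mono[OF _ std_gauss_nonneg, of "\<bar>f x\<bar>" "\<bar>M\<bar>" x]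
      by (simp add: abs_mult std_gauss_nonneg mult.commute)
  qed
qed simp

lemma integrable_std_gauss_norm4:
  "integrable lborel (\<lambda>x::'a::euclidean_space. std_gauss x * norm x ^ 4)"
proof (rule Bochner_Integration.integrable_bound)
  let ?g = "\<lambda>x::'a. std_gauss ((1/2) *\<^sub>R x)"
  have "lborel = density (distr lborel borel (\<lambda>x::'a. 0 + (1/2) *\<^sub>R x)) (\<lambda>_. ennreal (\<bar>1/2\<bar> ^ DIM('a)))"
    by (rule lborel_affine) simp
  then have "integrable (density (distr lborel borel (\<lambda>x::'a. (1/2) *\<^sub>R x)) (\<lambda>_. ennreal ((1/2) ^ DIM('a)))) (std_gauss :: 'a \<Rightarrow> real)"
    using integrable_std_gauss[where 'a = 'a] by simp
  then have "integrable lborel ?g"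
    by (simp add: integrable_density integrable_distr_eq)
  then show "integrable lborel (\<lambda>x. 128 * ?g x)" by simp
  have "std_gauss x * norm x ^ 4 \<le> 128 * ?g x" for x :: 'a
  proof -
    \<comment> \<open>The exponent of \<open>std_gauss x\<close> is -4r and that of
      \<open>std_gauss\<close> at x/2 is -r, while the fourth power of the norm is 64 times r
      squared. Since r squared is at most 2 exp r, the constant is 64 * 2 = 128, and exp (-3r) \<le>
      exp (-r) finishes.\<close>
    define r where "r = (x \<bullet> x) / 8"
    have r: "0 \<le> r" by (simp add: r_def)
    have "r\<^sup>2 / 2 \<le> exp r"
      using exp_lower_Taylor_quadratic[OF r] r by linarith
    then have "64 * r\<^sup>2 * exp (- 4 * r) \<le> 64 * (2 * exp r) * exp (- 4 * r)"
      by (intro mult_right_mono) auto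
    also have "\<dots> = 128 * exp (- 3 * r)" by (simp flip: exp_add)
    finally have "64 * r\<^sup>2 * exp (- 4 * r) \<le> 128 * exp (- 1 * r)"
      using r by (smt (verit, best) exp_le_cancel_iff)
    moreover have "norm x ^ 4 = 64 * r\<^sup>2"
      unfolding r_def dot_square_norm by (simp add: power_divide power_mult flip: power_mult)
    ultimately have "norm x ^ 4 * exp (- (x \<bullet> x) / 2) \<le> 128 * exp (- (x \<bullet> x) / 8)"
      by (simp add: r_def)
    then show ?thesis
      unfolding std_gauss_eq by (simp add: mult.commute mult.left_commute)
  qed
  then show "AE x in lborel. norm (std_gauss x * norm x ^ 4) \<le> norm (128 * ?g x)"
    by (auto simp: abs_mult std_gauss_nonneg)
qed simp

text \<open>The reflection x to -x preserves both the measure and the Gaussian, so the integral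
  equals its own negative. This argument needs no separate proof of integrability.\<close>

lemma integral_std_gauss_odd:
  fixes f :: "'a::euclidean_space \<Rightarrow> real"
  assumes "linear f"
  shows "(LINT x|lborel. std_gauss x * f x) = 0"
proof -
  have [measurable]: "f \<in> borel_measurable borel"
    using assms by (intro borel_measurable_continuous_onI linear_continuous_on linear_conv_bounded_linear[THEN iffD1])
  have "lborel = density (distr lborel borel (\<lambda>x::'a. 0 + (-1) *\<^sub>R x)) (\<lambda>_. ennreal (\<bar>-1\<bar> ^ DIM('a)))"
    by (rule lborel_affine) simp
  then have "lborel = distr lborel borel (uminus :: 'a \<Rightarrow> 'a)"
    by (simp add: density_1)
  then have "(LINT x|lborel. std_gauss x * f x) = (LINT x|distr lborel borel uminus. std_gauss x * f x)"
    by simp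
  also have "\<dots> = (LINT x|lborel. - (std_gauss x * f x))"
    by (subst integral_distr) (auto simp: std_gauss_uminus linear_neg[OF assms])
  finally show ?thesis by simp
qed

section \<open>Matrix exponentials and positive definite matrices\<close>

lemma bounded_bilinear_matrix_mult:
  "bounded_bilinear ((**) :: real^'n^'m \<Rightarrow> real^'p^'n \<Rightarrow> real^'p^'m)"
  unfolding bilinear_conv_bounded_bilinear[symmetric] bilinear_def
  by (auto intro!: linearI simp: vec_eq_iff matrix_matrix_mult_def sum.distrib algebra_simps sum_distrib_left)

lemma bounded_bilinear_matrix_vector_mult:
  "bounded_bilinear ((*v) :: real^'n^'m \<Rightarrow> real^'n \<Rightarrow> real^'m)"
  unfolding bilinear_conv_bounded_bilinear[symmetric] bilinear_def
  by (auto intro!: linearI simp: vec_eq_iff matrix_vector_mult_def sum.distrib algebra_simps sum_distrib_left)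

lemma bounded_linear_transpose: "bounded_linear (transpose :: real^'n^'m \<Rightarrow> real^'m^'n)"
  unfolding linear_conv_bounded_linear[symmetric]
  by (auto intro!: linearI simp: vec_eq_iff transpose_def)

lemmas matrix_mult_measurable [measurable (raw)] =
  borel_measurable_continuous_Pair[OF _ _ bounded_bilinear.continuous_on
    [OF bounded_bilinear_matrix_mult continuous_on_fst[OF continuous_on_id] continuous_on_snd[OF continuous_on_id]]]

lemmas matrix_vector_mult_measurable [measurable (raw)] =
  borel_measurable_continuous_Pair[OF _ _ bounded_bilinear.continuous_on
    [OF bounded_bilinear_matrix_vector_mult continuous_on_fst[OF continuous_on_id] continuous_on_snd[OF continuous_on_id]]]

lemma inner_matrix_vector_mult_left:
  fixes A :: "real^'n^'m"
  shows "(A *v x) \<bullet> y = x \<bullet> (transpose A *v y)"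
  by (metis dot_lmul_matrix inner_commute transpose_matrix_vector)

abbreviation matrix_pow :: "real^'n^'n \<Rightarrow> nat \<Rightarrow> real^'n^'n" where
  "matrix_pow A k \<equiv> ((**) A ^^ k) (mat 1)"

lemma matrix_pow_scaleR: "matrix_pow (c *\<^sub>R A) k = c ^ k *\<^sub>R matrix_pow A k"
  by (induction k)
    (simp_all add: bounded_bilinear.scaleR_left[OF bounded_bilinear_matrix_mult]
      bounded_bilinear.scaleR_right[OF bounded_bilinear_matrix_mult])

lemma matrix_pow_commute: "matrix_pow A k ** A = A ** matrix_pow A k"
  by (induction k) (simp_all add: matrix_mul_assoc[symmetric])

lemma transpose_matrix_pow: "transpose (matrix_pow A k) = matrix_pow (transpose A) k"
  by (induction k) (simp_all add: matrix_transpose_mul matrix_pow_commute transpose_mat)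

text \<open>The norm on matrices is the Euclidean one of the entries: \<open>mat 1\<close> need not
  have norm 1, and submultiplicativity is taken only up to the bilinear constant \<open>c\<close>,
  which \<open>d\<close> absorbs.\<close>

lemma norm_matrix_pow_le:
  fixes A :: "real^'n^'n"
  shows "\<exists>d\<ge>0. \<forall>k. norm (matrix_pow A k) \<le> d ^ k * norm (mat 1 :: real^'n^'n)"
proof -
  obtain c where c: "c > 0" "\<And>(A::real^'n^'n) (B::real^'n^'n). norm (A ** B) \<le> norm A * norm B * c"
    using bounded_bilinear.pos_bounded[OF bounded_bilinear_matrix_mult] by blast
  have "norm (matrix_pow A k) \<le> (c * norm A) ^ k * norm (mat 1 :: real^'n^'n)" for k
  proof (induction k)
    case (Suc k)
    have "norm (matrix_pow A (Suc k)) \<le> (c * norm A) * norm (matrix_pow A k)"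
      using c(2)[of A "matrix_pow A k"] by (simp add: ac_simps)
    also have "\<dots> \<le> (c * norm A) * ((c * norm A) ^ k * norm (mat 1 :: real^'n^'n))"
      using Suc c(1) by (intro mult_left_mono) auto
    finally show ?case by (simp add: ac_simps)
  qed simp
  then show ?thesis using c(1) by (intro exI[of _ "c * norm A"]) auto
qed

lemma summable_matrix_exp:
  fixes A :: "real^'n^'n"
  shows "summable (\<lambda>k. matrix_pow A k /\<^sub>R fact k)"
proof -
  obtain d where d: "0 \<le> d" "\<And>k. norm (matrix_pow A k) \<le> d ^ k * norm (mat 1 :: real^'n^'n)"
    using norm_matrix_pow_le[of A] by blast
  have "summable (\<lambda>k. inverse (fact k) * d ^ k * norm (mat 1 :: real^'n^'n))"
    by (rule summable_mult2[OF summable_exp])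
  moreover have "norm (matrix_pow A k /\<^sub>R fact k) \<le> inverse (fact k) * d ^ k * norm (mat 1 :: real^'n^'n)" for k
    using mult_left_mono[OF d(2)[of k], of "inverse (fact k)"] by (simp add: mult.assoc)
  ultimately show ?thesis by (rule summable_comparison_test'[where N = 0])
qed

text \<open>This makes \<open>cov\<close> a congruence E Q E^T, from which its symmetry and
  nonnegativity are visible.\<close>

lemma transpose_matrix_exp: "transpose (matrix_exp A) = matrix_exp (transpose A)"
  unfolding matrix_exp_def
  by (subst bounded_linear.suminf[OF bounded_linear_transpose summable_matrix_exp])
    (simp add: linear_scale[OF bounded_linear.linear, OF bounded_linear_transpose] transpose_matrix_pow)

lemma matrix_exp_scaleR_measurable [measurable]:
  "(\<lambda>\<sigma>. matrix_exp (\<sigma> *\<^sub>R B)) \<in> borel_measurable borel"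
  unfolding matrix_exp_def matrix_pow_scaleR by measurable

text \<open>Dropping the constant term of the series leaves powers \<sigma>^(k+1), each at most
  \<sigma> on [0,1]; the rest sums to a constant. Applied to \<open>X\<close>, this is the O(\<tau>)
  bound on the drift of the Gaussian mean.\<close>

lemma norm_matrix_exp_minus_one_le:
  fixes B :: "real^'n^'n"
  shows "\<exists>C\<ge>0. \<forall>\<sigma>\<in>{0..1}. norm (matrix_exp (\<sigma> *\<^sub>R B) - mat 1) \<le> C * \<sigma>"
proof -
  obtain d where d: "0 \<le> d" "\<And>k. norm (matrix_pow B k) \<le> d ^ k * norm (mat 1 :: real^'n^'n)"
    using norm_matrix_pow_le[of B] by blast
  let ?g = "\<lambda>k. inverse (fact (Suc k)) * d ^ (Suc k) * norm (mat 1 :: real^'n^'n)"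
  have g: "summable ?g"
    by (subst summable_Suc_iff) (intro summable_mult2 summable_exp)
  have "norm (matrix_exp (\<sigma> *\<^sub>R B) - mat 1) \<le> suminf ?g * \<sigma>" if \<sigma>: "\<sigma> \<in> {0..1}" for \<sigma>
  proof -
    let ?f = "\<lambda>k. matrix_pow (\<sigma> *\<^sub>R B) k /\<^sub>R fact k"
    have "matrix_exp (\<sigma> *\<^sub>R B) - mat 1 = (\<Sum>k. ?f (Suc k))"
      unfolding matrix_exp_def using suminf_split_head[OF summable_matrix_exp, of "\<sigma> *\<^sub>R B"] by simp
    also have "norm \<dots> \<le> (\<Sum>k. ?g k * \<sigma>)"
    proof (rule norm_suminf_le)
      fix k
      have "\<sigma> ^ Suc k \<le> \<sigma> ^ 1" using \<sigma> by (intro power_decreasing) auto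
      then have "\<sigma> ^ Suc k * norm (matrix_pow B (Suc k)) \<le> \<sigma> * (d ^ Suc k * norm (mat 1 :: real^'n^'n))"
        using \<sigma> d by (intro mult_mono) (auto simp del: power_Suc funpow.simps)
      from mult_left_mono[OF this, of "inverse (fact (Suc k))"] show "norm (?f (Suc k)) \<le> ?g k * \<sigma>"
        using \<sigma> unfolding matrix_pow_scaleR
        by (simp add: ac_simps del: power_Suc funpow.simps fact_Suc)
    qed (rule summable_mult2[OF g])
    finally show ?thesis using g by (simp add: suminf_mult2)
  qed
  moreover have "0 \<le> suminf ?g" using g d by (intro suminf_nonneg) auto
  ultimately show ?thesis by blast
qed

lemma norm_matrix_exp_le:
  fixes B :: "real^'n^'n"
  shows "\<exists>C. \<forall>\<sigma>\<in>{0..1}. norm (matrix_exp (\<sigma> *\<^sub>R B)) \<le> C"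
proof -
  obtain C where C: "0 \<le> C" "\<And>\<sigma>. \<sigma> \<in> {0..1} \<Longrightarrow> norm (matrix_exp (\<sigma> *\<^sub>R B) - mat 1) \<le> C * \<sigma>"
    using norm_matrix_exp_minus_one_le[of B] by blast
  show ?thesis
  proof (intro exI ballI)
    fix \<sigma> :: real assume \<sigma>: "\<sigma> \<in> {0..1}"
    have "C * \<sigma> \<le> C" using \<sigma> C(1) by (simp add: mult_left_le)
    then show "norm (matrix_exp (\<sigma> *\<^sub>R B)) \<le> C + norm (mat 1 :: real^'n^'n)"
      using C(2)[OF \<sigma>] norm_triangle_sub[of "matrix_exp (\<sigma> *\<^sub>R B)" "mat 1"] by linarith
  qed
qed

text \<open>If the form vanishes at x, then 0 is its minimum there, so the first variation in the
  direction \<open>M *v x\<close> must vanish. That variation is twice the squared length of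
  \<open>M *v x\<close>, which contradicts invertibility.\<close>

lemma psd_invertible_imp_pd:
  fixes M :: "real^'n^'n"
  assumes sym: "transpose M = M" and psd: "\<And>x. 0 \<le> (M *v x) \<bullet> x" and "invertible M" and "x \<noteq> 0"
  shows "0 < (M *v x) \<bullet> x"
proof (rule ccontr)
  let ?y = "M *v x"
  define c where "c = (M *v ?y) \<bullet> ?y"
  define a where "a = ?y \<bullet> ?y"
  \<comment> \<open>The step -a*k along \<open>M *v x\<close> is short enough for the linear term to
    beat the quadratic one, as k*c \<le> 1; the added 1 covers the case c = 0.\<close>
  define k where "k = 1 / (c + 1)"
  have c: "0 \<le> c" unfolding c_def by (rule psd)
  then have k: "0 < k" "k * c \<le> 1" by (simp_all add: k_def)
  assume "\<not> 0 < (M *v x) \<bullet> x"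
  then have 0: "(M *v x) \<bullet> x = 0" using psd[of x] by simp
  have 1: "(M *v ?y) \<bullet> x = a"
    by (subst inner_matrix_vector_mult_left) (simp add: sym a_def)
  have "0 \<le> 2 * e * a + e\<^sup>2 * c" for e
  proof -
    have "(M *v (x + e *\<^sub>R ?y)) \<bullet> (x + e *\<^sub>R ?y)
        = (M *v x) \<bullet> x + e * a + e * ((M *v ?y) \<bullet> x) + e * e * c"
      by (simp add: matrix_vector_right_distrib matrix_vector_mult_scaleR inner_add_left
          inner_add_right a_def c_def distrib_left)
    also have "\<dots> = 2 * e * a + e\<^sup>2 * c" by (simp add: 0 1 power2_eq_square)
    finally show ?thesis using psd[of "x + e *\<^sub>R ?y"] by simp
  qed
  from this[of "- a * k"] have "0 \<le> a\<^sup>2 * k * (k * c - 2)"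
    by (simp add: power2_eq_square algebra_simps)
  moreover have "a\<^sup>2 * k * (k * c - 2) \<le> a\<^sup>2 * k * (- 1)"
    using k by (intro mult_left_mono) auto
  ultimately have "a\<^sup>2 * k \<le> 0" by linarith
  then have "a = 0" using k by (simp add: mult_le_0_iff)
  then have "M *v x = 0" by (simp add: a_def)
  then show False using \<open>invertible M\<close> \<open>x \<noteq> 0\<close>
    by (metis invertible_def matrix_vector_mul_assoc matrix_vector_mul_lid matrix_vector_mult_0_right)
qed

text \<open>Gram-Schmidt for the inner product given by \<open>M\<close>: if the columns of
  \<open>W\<close> are \<open>M\<close>-orthonormal, then W^T M W = 1, and A = M W satisfies A A^T =
  M (W (M W)^T) = M. Any such factor serves; it need not be the symmetric square root.\<close>

lemma pd_eq_mult_transpose: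
  fixes M :: "real^'n^'n"
  assumes sym: "transpose M = M" and pd: "\<And>x. x \<noteq> 0 \<Longrightarrow> 0 < (M *v x) \<bullet> x"
  obtains A :: "real^'n^'n" where "invertible A" "M = A ** transpose A"
proof -
  have symm: "(M *v x) \<bullet> y = (M *v y) \<bullet> x" for x y
    by (metis inner_matrix_vector_mult_left sym inner_commute)
  have "\<exists>F :: nat \<Rightarrow> real^'n. \<forall>i<k. \<forall>j<k. (M *v F i) \<bullet> F j = of_bool (i = j)" if "k \<le> CARD('n)" for k
    using that
  proof (induction k)
    case (Suc k)
    then obtain F :: "nat \<Rightarrow> real^'n" where F: "\<And>i j. i < k \<Longrightarrow> j < k \<Longrightarrow> (M *v F i) \<bullet> F j = of_bool (i = j)"
      by auto
    \<comment> \<open>Euclidean orthogonality to \<open>M *v F i\<close> is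
      \<open>M\<close>-orthogonality to \<open>F i\<close>. Fewer than n such vectors do not span,
      so a further direction exists, and positivity of the form allows normalising it.\<close>
    let ?S = "(\<lambda>i. M *v F i) ` {..<k}"
    have "dim ?S \<le> card ?S" by (intro dim_le_card') simp
    also have "\<dots> \<le> k" using card_image_le[of "{..<k}"] by simp
    finally have "dim ?S < DIM(real^'n)" using Suc by simp
    then obtain x where x: "x \<noteq> 0" "\<And>y. y \<in> span ?S \<Longrightarrow> orthogonal x y"
      using orthogonal_to_subspace_exists by blast
    let ?v = "(1 / sqrt ((M *v x) \<bullet> x)) *\<^sub>R x"
    have "(M *v F i) \<bullet> x = 0" if "i < k" for i
      using x(2)[OF span_base, of "M *v F i"] that by (auto simp: orthogonal_def inner_commute)
    then have orth: "(M *v F i) \<bullet> ?v = 0" "(M *v ?v) \<bullet> F i = 0" if "i < k" for i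
      using that symm[of ?v "F i"] by auto
    have "(M *v ?v) \<bullet> ?v = 1"
      using pd[OF x(1)] by (simp add: matrix_vector_mult_scaleR)
    then have "\<forall>i<Suc k. \<forall>j<Suc k. (M *v (F(k := ?v)) i) \<bullet> (F(k := ?v)) j = of_bool (i = j)"
      using orth F by (auto simp: less_Suc_eq)
    then show ?case by blast
  qed simp
  then obtain F :: "nat \<Rightarrow> real^'n" where F: "\<And>i j. i < CARD('n) \<Longrightarrow> j < CARD('n) \<Longrightarrow> (M *v F i) \<bullet> F j = of_bool (i = j)"
    by blast
  obtain e :: "'n \<Rightarrow> nat" where e: "bij_betw e UNIV {..<CARD('n)}"
    using ex_bij_betw_finite_nat[of "UNIV :: 'n set"] by (auto simp: atLeast0LessThan)
  have eless: "e i < CARD('n)" for i using e bij_betwE by fastforce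
  have einj: "e i = e j \<longleftrightarrow> i = j" for i j using e by (auto simp: bij_betw_def inj_on_def)
  define W where "W = (\<chi> i j. F (e j) $ i)"
  have Wa: "W *v axis i 1 = F (e i)" for i
    by (simp add: W_def vec_eq_iff matrix_vector_mult_basis column_def)
  have WMW: "transpose W ** M ** W = mat 1"
  proof -
    have "(transpose W ** M ** W) $ i $ j = (mat 1 :: real^'n^'n) $ i $ j" for i j
    proof -
      have "(transpose W ** M ** W) $ i $ j = axis i 1 \<bullet> ((transpose W ** M ** W) *v axis j 1)"
        by (simp add: inner_axis' matrix_vector_mult_basis column_def)
      also have "\<dots> = (W *v axis i 1) \<bullet> (M *v (W *v axis j 1))"
        by (simp add: inner_matrix_vector_mult_left matrix_vector_mul_assoc matrix_mul_assoc)
      also have "\<dots> = of_bool (i = j)"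
        using F[of "e j" "e i"] eless by (simp add: Wa einj inner_commute eq_commute)
      finally show ?thesis by (simp add: mat_def)
    qed
    then show ?thesis by (simp add: vec_eq_iff)
  qed
  then have inv: "transpose W ** (M ** W) = mat 1"
    by (simp add: matrix_mul_assoc)
  then have inv': "(M ** W) ** transpose W = mat 1"
    by (subst matrix_left_right_inverse)
  then have invM: "invertible (M ** W)" unfolding invertible_def using inv by blast
  have "transpose (transpose W ** (M ** W)) = transpose (M ** W) ** W"
    by (simp add: matrix_transpose_mul)
  then have "transpose (M ** W) ** W = mat 1" by (simp add: inv transpose_mat)
  then have "W ** transpose (M ** W) = mat 1" by (subst matrix_left_right_inverse)
  then have "M = (M ** W) ** transpose (M ** W)"
    by (metis matrix_mul_assoc matrix_mul_rid)
  then show ?thesis by (rule that[OF invM])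
qed

section \<open>The covariance matrix and the kernel\<close>

lemma matrix_inv_vector_eqI:
  fixes A :: "real^'n^'n"
  assumes "invertible A" "A *v y = x"
  shows "matrix_inv A *v x = y"
proof -
  have "A ** matrix_inv A = mat 1 \<and> matrix_inv A ** A = mat 1"
    using assms(1) unfolding invertible_def matrix_inv_def by (rule someI_ex)
  then show ?thesis using assms(2) by (metis matrix_vector_mul_assoc matrix_vector_mul_lid)
qed

lemma det_scaleR:
  fixes M :: "real^'n^'n"
  shows "det (c *\<^sub>R M) = c ^ CARD('n) * det M"
proof -
  have "det (c *\<^sub>R (mat 1 :: real^'n^'n)) = c ^ CARD('n)"
    by (subst det_diagonal) (auto simp: mat_def)
  moreover have "c *\<^sub>R M = (c *\<^sub>R mat 1) ** M"
    by (simp add: bounded_bilinear.scaleR_left[OF bounded_bilinear_matrix_mult])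
  ultimately show ?thesis by (simp add: det_mul)
qed

lemma det_measurable [measurable (raw)]:
  fixes f :: "'a \<Rightarrow> real^'n^'n"
  assumes [measurable]: "f \<in> borel_measurable M"
  shows "(\<lambda>x. det (f x)) \<in> borel_measurable M"
proof -
  have [measurable]: "(\<lambda>x. f x $ i $ j) \<in> borel_measurable M" for i j
    by (rule measurable_compose[OF assms borel_measurable_continuous_onI]) (intro continuous_intros)
  show ?thesis unfolding det_def by measurable
qed

text \<open>Cauchy-Schwarz in each row; the squared row lengths add up to the trace of A A^T. This
  form is convenient because the factor \<open>A\<close> used later is known only through A A^T =
  2tK.\<close>

lemma norm_matrix_vector_mult_le_trace:
  fixes A :: "real^'n^'m"
  shows "(norm (A *v z))\<^sup>2 \<le> (\<Sum>i\<in>UNIV. (A ** transpose A) $ i $ i) * (norm z)\<^sup>2"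
proof -
  have "(norm (A *v z))\<^sup>2 = (\<Sum>i\<in>UNIV. ((A *v z) $ i)\<^sup>2)"
    unfolding power2_norm_eq_inner by (simp add: inner_vec_def power2_eq_square)
  also have "\<dots> \<le> (\<Sum>i\<in>UNIV. (norm (row i A))\<^sup>2 * (norm z)\<^sup>2)"
  proof (rule sum_mono)
    fix i
    have "(A *v z) $ i = row i A \<bullet> z"
      by (simp add: matrix_vector_mul_component row_def)
    then show "((A *v z) $ i)\<^sup>2 \<le> (norm (row i A))\<^sup>2 * (norm z)\<^sup>2"
      using Cauchy_Schwarz_ineq[of "row i A" z] by (simp add: power2_norm_eq_inner)
  qed
  also have "\<dots> = (\<Sum>i\<in>UNIV. (A ** transpose A) $ i $ i) * (norm z)\<^sup>2"
    by (simp add: sum_distrib_right power2_norm_eq_inner inner_vec_def matrix_matrix_mult_def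
        transpose_def row_def)
  finally show ?thesis .
qed

locale kolmogorov =
  fixes Q B :: "real ^ 'n ^ 'n"
  assumes Q_sym: "transpose Q = Q"
    and Q_nonneg: "\<And>x. 0 \<le> (Q *v x) \<bullet> x"
    and K_invertible: "\<And>t. 0 < t \<Longrightarrow> invertible (Kmat Q B t)"
begin

definition cov :: "real \<Rightarrow> real^'n^'n" where
  "cov \<sigma> = matrix_exp (\<sigma> *\<^sub>R B) ** Q ** matrix_exp (\<sigma> *\<^sub>R transpose B)"

lemma Kmat_eq: "Kmat Q B t = (1 / t) *\<^sub>R integral {0..t} cov"
  by (simp add: Kmat_def cov_def[abs_def])

lemma cov_eq: "cov \<sigma> = matrix_exp (\<sigma> *\<^sub>R B) ** Q ** transpose (matrix_exp (\<sigma> *\<^sub>R B))"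
  by (simp add: cov_def transpose_matrix_exp linear_scale[OF bounded_linear.linear, OF bounded_linear_transpose])

text \<open>A non-integrable integrand would have the junk integral \<open>0\<close>, contradicting invertibility.\<close>

lemma cov_integrable: "0 < t \<Longrightarrow> cov integrable_on {0..t}"
proof (rule ccontr)
  assume t: "0 < t" and "\<not> cov integrable_on {0..t}"
  then have "Kmat Q B t = 0" by (simp add: Kmat_eq not_integrable_integral)
  then have "invertible (0 :: real^'n^'n)" using K_invertible[OF t] by simp
  then show False using det_scaleR[of 0 "mat 1 :: real^'n^'n"] by (simp add: invertible_det_nz)
qed

text \<open>Serves to carry properties of \<open>cov\<close> over to its mean, with transposition
  and the quadratic form in the role of \<open>f\<close>.\<close>

lemma Kmat_linear:
  fixes f :: "real^'n^'n \<Rightarrow> 'b::euclidean_space"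
  assumes t: "0 < t" and f: "bounded_linear f"
  shows "((\<lambda>\<sigma>. f (cov \<sigma>)) has_integral t *\<^sub>R f (Kmat Q B t)) {0..t}"
proof -
  have "((f \<circ> cov) has_integral f (integral {0..t} cov)) {0..t}"
    by (intro has_integral_linear f integrable_integral cov_integrable t)
  then show ?thesis
    using t by (simp add: Kmat_eq linear_scale[OF bounded_linear.linear[OF f]] o_def)
qed

lemma Kmat_sym: assumes "0 < t" shows "transpose (Kmat Q B t) = Kmat Q B t"
proof -
  have "transpose (cov \<sigma>) = cov \<sigma>" for \<sigma>
    by (simp add: cov_eq matrix_transpose_mul transpose_transpose Q_sym matrix_mul_assoc)
  then have "t *\<^sub>R transpose (Kmat Q B t) = t *\<^sub>R Kmat Q B t"
    using Kmat_linear[OF assms bounded_linear_transpose] Kmat_linear[OF assms bounded_linear_ident]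
    by (metis (mono_tags, lifting) has_integral_unique has_integral_cong)
  then show ?thesis using assms by simp
qed

lemma Kmat_psd: assumes "0 < t" shows "0 \<le> (Kmat Q B t *v x) \<bullet> x"
proof -
  have "bounded_linear (\<lambda>M. (M *v x) \<bullet> x)"
    by (intro bounded_linear_intros bounded_linear_inner_left_comp
        bounded_bilinear.bounded_linear_left[OF bounded_bilinear_matrix_vector_mult])
  from Kmat_linear[OF assms this] have "0 \<le> t *\<^sub>R ((Kmat Q B t *v x) \<bullet> x)"
  proof (rule has_integral_nonneg)
    fix \<sigma>
    let ?E = "matrix_exp (\<sigma> *\<^sub>R B)"
    have "(cov \<sigma> *v x) \<bullet> x = (Q *v (transpose ?E *v x)) \<bullet> (transpose ?E *v x)"
      by (simp add: cov_eq inner_matrix_vector_mult_left flip: matrix_vector_mul_assoc)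
    then show "0 \<le> (cov \<sigma> *v x) \<bullet> x" using Q_nonneg by simp
  qed
  then show ?thesis using assms by (simp add: zero_le_mult_iff)
qed

lemma Kmat_bounded: "\<exists>C\<ge>0. \<forall>t\<in>{0<..1}. norm (Kmat Q B t) \<le> C"
proof -
  obtain c where c: "c > 0" "\<And>(A::real^'n^'n) (B::real^'n^'n). norm (A ** B) \<le> norm A * norm B * c"
    using bounded_bilinear.pos_bounded[OF bounded_bilinear_matrix_mult] by blast
  obtain C1 where C1: "\<And>\<sigma>. \<sigma> \<in> {0..1} \<Longrightarrow> norm (matrix_exp (\<sigma> *\<^sub>R B)) \<le> C1"
    using norm_matrix_exp_le[of B] by blast
  obtain C2 where C2: "\<And>\<sigma>. \<sigma> \<in> {0..1} \<Longrightarrow> norm (matrix_exp (\<sigma> *\<^sub>R transpose B)) \<le> C2"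
    using norm_matrix_exp_le[of "transpose B"] by blast
  have C12: "0 \<le> C1" "0 \<le> C2" using C1[of 0] C2[of 0] by (auto intro: order_trans[OF norm_ge_zero])
  let ?C = "C1 * norm Q * c * C2 * c"
  have bd: "norm (cov \<sigma>) \<le> ?C" if "\<sigma> \<in> {0..1}" for \<sigma>
  proof -
    let ?E = "matrix_exp (\<sigma> *\<^sub>R B)"
    have "norm (cov \<sigma>) \<le> norm (?E ** Q) * norm (matrix_exp (\<sigma> *\<^sub>R transpose B)) * c"
      unfolding cov_def by (rule c)
    also have "\<dots> \<le> (C1 * norm Q * c) * C2 * c"
    proof -
      have "norm (?E ** Q) \<le> norm ?E * norm Q * c" by (rule c)
      also have "\<dots> \<le> C1 * norm Q * c"
        using c C1[OF that] by (intro mult_right_mono) auto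
      finally show ?thesis
        using c C12 C2[OF that] by (intro mult_right_mono mult_mono mult_nonneg_nonneg) auto
    qed
    finally show ?thesis .
  qed
  have C0: "0 \<le> ?C" using C12 c by simp
  have "norm (Kmat Q B t) \<le> ?C" if t: "t \<in> {0<..1}" for t
  proof -
    have "norm (integral {0..t} cov) \<le> ?C * measure lborel (cbox 0 t)"
    proof (rule has_integral_bound[OF C0])
      show "(cov has_integral integral {0..t} cov) (cbox 0 t)"
        using cov_integrable[of t] t by (simp add: integrable_integral)
    qed (use bd t in auto)
    then show ?thesis using t by (simp add: Kmat_eq divide_simps mult.commute)
  qed
  then show ?thesis using C0 by blast
qed

text \<open>On the nonnegative half-line the indefinite integral is continuous, and for negative t
  the interval \<open>{0..t}\<close> is empty and the integral is 0. The two pieces are glued by a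
  case distinction with equal branches.\<close>

lemma Kmat_measurable [measurable]: "Kmat Q B \<in> borel_measurable borel"
proof -
  let ?G = "\<lambda>t. integral {0..t} cov"
  have "continuous_on {0..} ?G"
  proof (rule continuous_on_subset[of "\<Union>n::nat. {0..<real n}"])
    have "continuous (at x within {0..}) ?G" if "x \<in> {0..}" for x
    proof -
      have "continuous_on {0..x + 1} ?G"
        using that by (intro indefinite_integral_continuous_1 cov_integrable) auto
      then have "continuous (at x within {0..x+1}) ?G"
        using that by (simp add: continuous_on_eq_continuous_within)
      moreover have "at x within {0..} = at x within {0..x+1}"
        using that by (intro at_within_nhd[of x "{..<x+1}"]) auto
      ultimately show ?thesis by (simp add: continuous_within)
    qed
    then have "continuous_on {0..} ?G" by (simp add: continuous_on_eq_continuous_within)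
    then show "continuous_on (\<Union>n::nat. {0..<real n}) ?G"
      by (rule continuous_on_subset) auto
    show "{0::real..} \<subseteq> (\<Union>n::nat. {0..<real n})"
      by (auto simp: reals_Archimedean2)
  qed
  moreover have "continuous_on (- {0..}) ?G"
    by (subst continuous_on_cong[OF refl, of _ _ "\<lambda>_. 0"]) auto
  ultimately have "(\<lambda>t. if t \<in> {0..} then ?G t else ?G t) \<in> borel_measurable borel"
    by (intro borel_measurable_continuous_on_if) auto
  then have [measurable]: "?G \<in> borel_measurable borel" by simp
  show ?thesis unfolding Kmat_eq by measurable
qed

text \<open>Taking determinants in 2tK = A A^T gives (det A)^2 = 2^n det(tK), so the Jacobian
  cancels the determinant factor and turns the power of 4 pi into that of 2 pi. The trace of 2tK, at
  most 2tn times the norm of K, bounds the stretching by \<open>A\<close>.\<close>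

lemma kernel_gaussian:
  assumes t: "0 < t"
  obtains A :: "real^'n^'n" where "det A \<noteq> 0"
    "\<And>X Z. \<bar>det A\<bar> * kernel Q B X (matrix_exp (t *\<^sub>R B) *v X + A *v Z) t = std_gauss Z"
    "\<And>Z. (norm (A *v Z))\<^sup>2 \<le> 2 * t * CARD('n) * norm (Kmat Q B t) * (norm Z)\<^sup>2"
proof -
  let ?K = "Kmat Q B t"
  let ?n = "CARD('n)"
  have K_pos: "0 < (?K *v x) \<bullet> x" if "x \<noteq> 0" for x
    using psd_invertible_imp_pd[OF Kmat_sym[OF t] Kmat_psd[OF t] K_invertible[OF t] that] .
  have "\<exists>A :: real^'n^'n. invertible A \<and> (2 * t) *\<^sub>R ?K = A ** transpose A"
  proof (rule pd_eq_mult_transpose)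
    show "transpose ((2 * t) *\<^sub>R ?K) = (2 * t) *\<^sub>R ?K"
      by (simp add: linear_scale[OF bounded_linear.linear, OF bounded_linear_transpose] Kmat_sym t)
    show "0 < (((2 * t) *\<^sub>R ?K) *v x) \<bullet> x" if "x \<noteq> 0" for x
      using K_pos[OF that] t
      by (simp add: bounded_bilinear.scaleR_left[OF bounded_bilinear_matrix_vector_mult])
  qed blast
  then obtain A :: "real^'n^'n" where A: "invertible A" "(2 * t) *\<^sub>R ?K = A ** transpose A" by blast
  then obtain A' where A': "A ** A' = mat 1" "A' ** A = mat 1" unfolding invertible_def by blast
  have detA: "det A \<noteq> 0" using A(1) by (simp add: invertible_det_nz)
  let ?D = "det (t *\<^sub>R ?K)"
  have "(2 * t) *\<^sub>R ?K = 2 *\<^sub>R (t *\<^sub>R ?K)" by simp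
  then have D: "2 ^ ?n * ?D = (det A)\<^sup>2"
    using A(2) by (metis det_scaleR det_mul det_transpose power2_eq_square)
  have "0 < 2 ^ ?n * ?D" unfolding D using detA by simp
  then have D0: "0 < ?D" by (simp add: zero_less_mult_iff)
  have absdet: "\<bar>det A\<bar> = 2 powr (?n / 2) * ?D powr (1/2)"
  proof -
    have "\<bar>det A\<bar> = sqrt (2 ^ ?n * ?D)" by (simp add: D)
    also have "\<dots> = (2 powr real ?n * ?D) powr (1/2)"
      using D0 by (simp add: powr_half_sqrt powr_realpow)
    finally show ?thesis using D0 by (simp add: powr_mult powr_powr)
  qed
  have normalise: "\<bar>det A\<bar> * ((4 * pi) powr (- (real ?n / 2)) * ?D powr (- (1 / 2))) = (2 * pi) powr (- (real ?n / 2))"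
  proof -
    have "(4 * pi) powr (- (real ?n / 2)) = 2 powr (- (real ?n / 2)) * (2 * pi) powr (- (real ?n / 2))"
      by (simp flip: powr_mult)
    moreover have "2 powr (?n / 2) * 2 powr (- (real ?n / 2)) = 1" "?D powr (1/2) * ?D powr (- (1/2)) = 1"
      using D0 by (simp_all flip: powr_add)
    ultimately show ?thesis unfolding absdet by (simp add: mult.commute mult.left_commute)
  qed
  \<comment> \<open>With \<open>A'\<close> the inverse of \<open>A\<close>, the relation 2tK = A A^T
    reads K^{-1} A = 2t A'^T, and A'^T Z paired with A Z is Z paired with itself.\<close>
  have exponent: "((matrix_inv ?K *v (A *v Z)) \<bullet> (A *v Z)) / (4 * t) = (Z \<bullet> Z) / 2" for Z
  proof -
    have "transpose A ** transpose A' = mat 1"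
      by (metis A'(2) matrix_transpose_mul transpose_mat)
    then have "A *v Z = (A ** transpose A) *v (transpose A' *v Z)"
      by (metis matrix_vector_mul_assoc matrix_vector_mul_lid)
    also have "\<dots> = ?K *v ((2 * t) *\<^sub>R (transpose A' *v Z))"
      unfolding A(2)[symmetric]
      by (simp add: bounded_bilinear.scaleR_left[OF bounded_bilinear_matrix_vector_mult]
          bounded_bilinear.scaleR_right[OF bounded_bilinear_matrix_vector_mult])
    finally have "matrix_inv ?K *v (A *v Z) = (2 * t) *\<^sub>R (transpose A' *v Z)"
      using matrix_inv_vector_eqI[OF K_invertible[OF t]] by simp
    moreover have "(transpose A' *v Z) \<bullet> (A *v Z) = Z \<bullet> Z"
      by (metis A'(2) inner_matrix_vector_mult_left transpose_transpose matrix_vector_mul_assoc matrix_vector_mul_lid)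
    ultimately show ?thesis using t by simp
  qed
  show ?thesis
  proof (rule that[OF detA])
    show "\<bar>det A\<bar> * kernel Q B X (matrix_exp (t *\<^sub>R B) *v X + A *v Z) t = std_gauss Z" for X Z
      using arg_cong[OF normalise, of "\<lambda>x. x * exp (- (Z \<bullet> Z / 2))"]
      by (simp add: kernel_def std_gauss_eq exponent mult.assoc)
    show "(norm (A *v Z))\<^sup>2 \<le> 2 * t * ?n * norm ?K * (norm Z)\<^sup>2" for Z
    proof -
      have "(\<Sum>i\<in>UNIV. (A ** transpose A) $ i $ i) \<le> (\<Sum>i\<in>(UNIV::'n set). 2 * t * norm ?K)"
      proof (rule sum_mono)
        fix i
        have "?K $ i $ i \<le> norm ?K"
          using component_le_norm_cart[of "?K $ i" i] Finite_Cartesian_Product.norm_nth_le[of ?K i] by linarith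
        then show "(A ** transpose A) $ i $ i \<le> 2 * t * norm ?K"
          using t unfolding A(2)[symmetric] by simp
      qed
      then have "(\<Sum>i\<in>UNIV. (A ** transpose A) $ i $ i) * (norm Z)\<^sup>2 \<le> (?n * (2 * t * norm ?K)) * (norm Z)\<^sup>2"
        by (intro mult_right_mono) auto
      with norm_matrix_vector_mult_le_trace[of A Z] show ?thesis by (simp add: ac_simps)
    qed
  qed
qed

end

section \<open>Joint measurability of the kernel and the Gaussian form of the semigroup\<close>

context kolmogorov
begin

text \<open>\<open>matrix_inv\<close> is defined by choice, so its measurability is not visible.
  Cramer's rule replaces the inverse by quotients of determinants, which are polynomials in the
  entries; the cut at \<tau> \<le> 0 removes the times at which K need not be invertible.\<close>

lemma kernel_measurable:
  "(\<lambda>(\<tau>, Y). if 0 < \<tau> then kernel Q B X Y \<tau> else 0) \<in> borel_measurable (borel \<Otimes>\<^sub>M borel)"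
proof -
  let ?v = "\<lambda>\<tau> Y. Y - matrix_exp (\<tau> *\<^sub>R B) *v X"
  let ?C = "\<lambda>\<tau> Y k. \<chi> i j. if j = k then ?v \<tau> Y $ i else Kmat Q B \<tau> $ i $ j"
  let ?q = "\<lambda>\<tau> Y. \<Sum>k\<in>UNIV. det (?C \<tau> Y k) / det (Kmat Q B \<tau>) * ?v \<tau> Y $ k"
  have q: "(matrix_inv (Kmat Q B \<tau>) *v ?v \<tau> Y) \<bullet> ?v \<tau> Y = ?q \<tau> Y" if "0 < \<tau>" for \<tau> Y
  proof -
    have inv: "invertible (Kmat Q B \<tau>)" using K_invertible[OF that] .
    let ?x = "\<chi> k. det (?C \<tau> Y k) / det (Kmat Q B \<tau>)"
    have "Kmat Q B \<tau> *v ?x = ?v \<tau> Y"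
      using inv by (subst cramer) (auto simp: invertible_det_nz)
    then have "matrix_inv (Kmat Q B \<tau>) *v ?v \<tau> Y = ?x"
      by (rule matrix_inv_vector_eqI[OF inv])
    then show ?thesis by (simp add: inner_vec_def)
  qed
  have nth [measurable]: "(\<lambda>v::real^'n. v $ i) \<in> borel_measurable borel" for i
    by (intro borel_measurable_continuous_onI continuous_intros)
  have nth2 [measurable]: "(\<lambda>M::real^'n^'n. M $ i $ j) \<in> borel_measurable borel" for i j
    by (intro borel_measurable_continuous_onI continuous_intros)
  have [measurable]: "(\<lambda>p. det (?C (fst p) (snd p) k)) \<in> borel_measurable (borel \<Otimes>\<^sub>M borel)" for k
    unfolding det_def by (simp only: vec_lambda_beta) measurable
  have "(\<lambda>(\<tau>, Y). if 0 < \<tau> then kernel Q B X Y \<tau> else 0) = (\<lambda>p. if 0 < fst p then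
      (4 * pi) powr (- (real CARD('n) / 2)) * det (fst p *\<^sub>R Kmat Q B (fst p)) powr (- (1 / 2)) *
      exp (- (?q (fst p) (snd p) / (4 * fst p))) else 0)"
  proof (rule ext)
    fix p :: "real \<times> (real^'n)"
    obtain \<tau> Y where p: "p = (\<tau>, Y)" by (cases p)
    show "(\<lambda>(\<tau>, Y). if 0 < \<tau> then kernel Q B X Y \<tau> else 0) p = (if 0 < fst p then
      (4 * pi) powr (- (real CARD('n) / 2)) * det (fst p *\<^sub>R Kmat Q B (fst p)) powr (- (1 / 2)) *
      exp (- (?q (fst p) (snd p) / (4 * fst p))) else 0)"
      unfolding p prod.case fst_conv snd_conv kernel_def by (cases "0 < \<tau>") (simp_all only: q if_True if_False)
  qed
  also have "\<dots> \<in> borel_measurable (borel \<Otimes>\<^sub>M borel)"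
    by measurable
  finally show ?thesis .
qed

lemma kernel_measurable_snd:
  assumes "0 < \<tau>" shows "(\<lambda>Y. kernel Q B X Y \<tau>) \<in> borel_measurable borel"
  using measurable_compose[OF measurable_Pair1', OF _ kernel_measurable[of X], of \<tau>] assms by simp

lemma semigroup_P_measurable:
  assumes [measurable]: "w \<in> borel_measurable borel"
  shows "set_borel_measurable borel {0<..} (\<lambda>\<tau>. semigroup_P Q B \<tau> w z)"
proof -
  obtain X t where z: "z = (X, t)" by fastforce
  note kernel_measurable[of X, measurable]
  have [measurable]: "(\<lambda>p. w (snd p, t - fst p)) \<in> borel_measurable (borel \<Otimes>\<^sub>M borel)"
    by (rule measurable_compose[OF _ assms]) (simp add: borel_prod[symmetric])
  have "(\<lambda>p. (\<lambda>(\<tau>, Y). if 0 < \<tau> then kernel Q B X Y \<tau> else 0) p * w (snd p, t - fst p))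
      \<in> borel_measurable (borel \<Otimes>\<^sub>M lborel)"
    by measurable
  then have "(\<lambda>\<tau>. LINT Y|lborel. (if 0 < \<tau> then kernel Q B X Y \<tau> else 0) * w (Y, t - \<tau>))
      \<in> borel_measurable borel"
    by (intro lborel.borel_measurable_lebesgue_integral) (simp add: case_prod_unfold)
  also have "(\<lambda>\<tau>. LINT Y|lborel. (if 0 < \<tau> then kernel Q B X Y \<tau> else 0) * w (Y, t - \<tau>))
      = (\<lambda>\<tau>. indicator {0<..} \<tau> *\<^sub>R semigroup_P Q B \<tau> w z)"
    by (rule ext) (auto simp: z semigroup_P_def indicator_def)
  finally show ?thesis unfolding set_borel_measurable_def .
qed

text \<open>\<open>A\<close> is chosen separately for each \<tau>, with no measurability in \<tau>;
  this is why \<open>semigroup_P_measurable\<close> is proved from the kernel. The equivalence of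
  integrability accompanies the formula because equality of the integrals alone says nothing about
  convergence.\<close>

lemma gaussian_representation:
  obtains A :: "real \<Rightarrow> real^'n^'n" and m :: "real \<Rightarrow> real^'n" and C
  where "0 \<le> C"
    "\<And>\<tau> w. 0 < \<tau> \<Longrightarrow> w \<in> borel_measurable borel \<Longrightarrow>
       semigroup_P Q B \<tau> w (X, t) = (LINT Z|lborel. std_gauss Z * w (m \<tau> + A \<tau> *v Z, t - \<tau>))"
    "\<And>\<tau> w. 0 < \<tau> \<Longrightarrow> w \<in> borel_measurable borel \<Longrightarrow>
       integrable lborel (\<lambda>Y. kernel Q B X Y \<tau> * w (Y, t - \<tau>)) \<longleftrightarrow>
       integrable lborel (\<lambda>Z. std_gauss Z * w (m \<tau> + A \<tau> *v Z, t - \<tau>))"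
    "\<And>\<tau>. \<tau> \<in> {0<..1} \<Longrightarrow> norm (m \<tau> - X) \<le> C * \<tau>"
    "\<And>\<tau> Z. \<tau> \<in> {0<..1} \<Longrightarrow> norm (A \<tau> *v Z) \<le> C * sqrt \<tau> * norm Z"
proof -
  define m where "m \<tau> = matrix_exp (\<tau> *\<^sub>R B) *v X" for \<tau>
  have "\<forall>\<tau>. \<exists>A :: real^'n^'n. 0 < \<tau> \<longrightarrow> det A \<noteq> 0 \<and>
      (\<forall>Z. \<bar>det A\<bar> * kernel Q B X (m \<tau> + A *v Z) \<tau> = std_gauss Z) \<and>
      (\<forall>Z. (norm (A *v Z))\<^sup>2 \<le> 2 * \<tau> * CARD('n) * norm (Kmat Q B \<tau>) * (norm Z)\<^sup>2)"
    unfolding m_def using kernel_gaussian by metis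
  then obtain A :: "real \<Rightarrow> real^'n^'n" where
    detA: "\<And>\<tau>. 0 < \<tau> \<Longrightarrow> det (A \<tau>) \<noteq> 0" and
    gauss: "\<And>\<tau> Z. 0 < \<tau> \<Longrightarrow> \<bar>det (A \<tau>)\<bar> * kernel Q B X (m \<tau> + A \<tau> *v Z) \<tau> = std_gauss Z" and
    normA: "\<And>\<tau> Z. 0 < \<tau> \<Longrightarrow> (norm (A \<tau> *v Z))\<^sup>2 \<le> 2 * \<tau> * CARD('n) * norm (Kmat Q B \<tau>) * (norm Z)\<^sup>2"
    by metis
  obtain Ck where Ck: "0 \<le> Ck" "\<And>\<tau>. \<tau> \<in> {0<..1} \<Longrightarrow> norm (Kmat Q B \<tau>) \<le> Ck"
    using Kmat_bounded by blast
  obtain Ce where Ce: "0 \<le> Ce" "\<And>\<sigma>. \<sigma> \<in> {0..1} \<Longrightarrow> norm (matrix_exp (\<sigma> *\<^sub>R B) - mat 1) \<le> Ce * \<sigma>"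
    using norm_matrix_exp_minus_one_le[of B] by blast
  obtain c where c: "c > 0" "\<And>(A::real^'n^'n) x. norm (A *v x) \<le> norm A * norm x * c"
    using bounded_bilinear.pos_bounded[OF bounded_bilinear_matrix_vector_mult] by blast
  define Cm where "Cm = Ce * norm X * c"
  define Ca where "Ca = sqrt (2 * CARD('n) * Ck)"
  have C0: "0 \<le> Cm" "0 \<le> Ca" using c Ce Ck by (auto simp: Cm_def Ca_def)
  show ?thesis
  proof (rule that[of "Cm + Ca" m A])
    show "0 \<le> Cm + Ca" using C0 by simp
  next
    fix \<tau> :: real and w :: "(real^'n) \<times> real \<Rightarrow> real"
    assume \<tau>: "0 < \<tau>" and [measurable]: "w \<in> borel_measurable borel"
    let ?f = "\<lambda>Y. kernel Q B X Y \<tau> * w (Y, t - \<tau>)"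
    note kernel_measurable_snd[OF \<tau>, measurable]
    have [measurable]: "(\<lambda>Y. w (Y, t - \<tau>)) \<in> borel_measurable borel"
      by (rule measurable_compose[OF _ \<open>w \<in> borel_measurable borel\<close>]) (simp add: borel_prod[symmetric])
    have eq: "\<bar>det (A \<tau>)\<bar> * ?f (m \<tau> + A \<tau> *v Z) = std_gauss Z * w (m \<tau> + A \<tau> *v Z, t - \<tau>)" for Z
      using gauss[OF \<tau>, of Z] by (metis mult.assoc)
    have "semigroup_P Q B \<tau> w (X, t) = \<bar>det (A \<tau>)\<bar> * (LINT Z|lborel. ?f (m \<tau> + A \<tau> *v Z))"
      unfolding semigroup_P_def prod.case by (rule integral_affine_matrix[OF detA[OF \<tau>]]) measurable
    then show "semigroup_P Q B \<tau> w (X, t) = (LINT Z|lborel. std_gauss Z * w (m \<tau> + A \<tau> *v Z, t - \<tau>))"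
      by (simp only: eq flip: integral_mult_right_zero)
    have "integrable lborel ?f \<longleftrightarrow> integrable lborel (\<lambda>Z. ?f (m \<tau> + A \<tau> *v Z))"
      by (rule integrable_affine_matrix[OF detA[OF \<tau>]]) measurable
    also have "\<dots> \<longleftrightarrow> integrable lborel (\<lambda>Z. \<bar>det (A \<tau>)\<bar> * ?f (m \<tau> + A \<tau> *v Z))"
      using detA[OF \<tau>] by simp
    finally show "integrable lborel ?f \<longleftrightarrow>
        integrable lborel (\<lambda>Z. std_gauss Z * w (m \<tau> + A \<tau> *v Z, t - \<tau>))"
      by (simp only: eq)
  next
    fix \<tau> :: real assume \<tau>: "\<tau> \<in> {0<..1}"
    have "m \<tau> - X = (matrix_exp (\<tau> *\<^sub>R B) - mat 1) *v X"
      by (simp add: m_def bounded_bilinear.diff_left[OF bounded_bilinear_matrix_vector_mult])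
    also have "norm \<dots> \<le> norm (matrix_exp (\<tau> *\<^sub>R B) - mat 1) * norm X * c" by (rule c)
    also have "\<dots> \<le> (Ce * \<tau>) * norm X * c"
      using Ce(2)[of \<tau>] \<tau> c by (intro mult_right_mono) auto
    also have "\<dots> = Cm * \<tau>" by (simp add: Cm_def)
    also have "\<dots> \<le> (Cm + Ca) * \<tau>" using C0 \<tau> by (intro mult_right_mono) auto
    finally show "norm (m \<tau> - X) \<le> (Cm + Ca) * \<tau>" .
    fix Z
    have "(norm (A \<tau> *v Z))\<^sup>2 \<le> 2 * \<tau> * CARD('n) * norm (Kmat Q B \<tau>) * (norm Z)\<^sup>2"
      using normA \<tau> by simp
    also have "\<dots> \<le> 2 * \<tau> * CARD('n) * Ck * (norm Z)\<^sup>2"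
      using Ck(2)[OF \<tau>] \<tau> by (intro mult_right_mono mult_left_mono) auto
    also have "\<dots> = (Ca * sqrt \<tau> * norm Z)\<^sup>2"
      using \<tau> Ck by (simp add: Ca_def power_mult_distrib)
    finally have "norm (A \<tau> *v Z) \<le> Ca * sqrt \<tau> * norm Z"
      using C0 \<tau> by (intro power2_le_imp_le[of "norm (A \<tau> *v Z)"]) auto
    also have "\<dots> \<le> (Cm + Ca) * sqrt \<tau> * norm Z" using C0 \<tau> by (intro mult_right_mono) auto
    finally show "norm (A \<tau> *v Z) \<le> (Cm + Ca) * sqrt \<tau> * norm Z" .
  qed
qed

end

section \<open>Taylor estimates\<close>

lemma frechet_derivative_eq_sum_Basis:
  fixes g :: "'a::euclidean_space \<Rightarrow> real"
  assumes "g differentiable at x"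
  shows "frechet_derivative g (at x) h = (\<Sum>b\<in>Basis. (h \<bullet> b) * frechet_derivative g (at x) b)"
proof -
  have lin: "linear (frechet_derivative g (at x))"
    using assms by (rule linear_frechet_derivative)
  have "frechet_derivative g (at x) h = frechet_derivative g (at x) (\<Sum>b\<in>Basis. (h \<bullet> b) *\<^sub>R b)"
    by (simp add: euclidean_representation)
  also have "\<dots> = (\<Sum>b\<in>Basis. (h \<bullet> b) * frechet_derivative g (at x) b)"
    by (simp add: linear_sum[OF lin] linear_scale[OF lin])
  finally show ?thesis .
qed

lemma schwartz_differentiable:
  assumes "schwartz u" "set vs \<subseteq> Basis"
  shows "iter_deriv vs u differentiable at x"
  using assms by (auto simp: schwartz_def differentiable_on_def)

lemma schwartz_iter_deriv_bounded:
  assumes "schwartz u" "set vs \<subseteq> Basis"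
  shows "\<exists>C\<ge>0. \<forall>x. \<bar>iter_deriv vs u x\<bar> \<le> C"
proof -
  have "\<exists>C. \<forall>x. norm x ^ 0 * \<bar>iter_deriv vs u x\<bar> \<le> C"
    using assms unfolding schwartz_def by blast
  then show ?thesis by (auto intro: order_trans[OF abs_ge_zero])
qed

text \<open>The next derivatives in the coordinate directions are bounded, so the mean value
  inequality applies. Used with \<open>vs = []\<close> for \<open>u\<close> itself and with
  \<open>vs = [b]\<close> for the components of its gradient.\<close>

lemma schwartz_iter_deriv_lipschitz:
  fixes u :: "'a::euclidean_space \<Rightarrow> real"
  assumes u: "schwartz u" and vs: "set vs \<subseteq> Basis"
  shows "\<exists>L\<ge>0. \<forall>x y. \<bar>iter_deriv vs u y - iter_deriv vs u x\<bar> \<le> L * norm (y - x)"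
proof -
  let ?g = "iter_deriv vs u"
  have "\<forall>b\<in>Basis. \<exists>C\<ge>0. \<forall>x. \<bar>iter_deriv (b # vs) u x\<bar> \<le> C"
    using vs by (intro ballI schwartz_iter_deriv_bounded[OF u]) auto
  then obtain C where C: "\<And>b. b \<in> Basis \<Longrightarrow> 0 \<le> C b"
    "\<And>b x. b \<in> Basis \<Longrightarrow> \<bar>frechet_derivative ?g (at x) b\<bar> \<le> C b"
    by (simp add: bchoice_iff) metis
  have "\<bar>?g y - ?g x\<bar> \<le> sum C Basis * norm (y - x)" for x y
  proof -
    have "norm (?g y - ?g x) \<le> sum C Basis * norm (y - x)"
    proof (rule differentiable_bound[of UNIV _ "\<lambda>x. frechet_derivative ?g (at x)"])
      fix x
      show "(?g has_derivative frechet_derivative ?g (at x)) (at x within UNIV)"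
        using schwartz_differentiable[OF u vs] by (simp add: frechet_derivative_works)
      show "onorm (frechet_derivative ?g (at x)) \<le> sum C Basis"
      proof (rule onorm_le)
        fix h
        have "\<bar>frechet_derivative ?g (at x) h\<bar> \<le> (\<Sum>b\<in>Basis. \<bar>(h \<bullet> b) * frechet_derivative ?g (at x) b\<bar>)"
          unfolding frechet_derivative_eq_sum_Basis[OF schwartz_differentiable[OF u vs], of x h] by (rule sum_abs)
        also have "\<dots> \<le> (\<Sum>b\<in>Basis. norm h * C b)"
          unfolding abs_mult using C by (intro sum_mono mult_mono Basis_le_norm) auto
        finally show "norm (frechet_derivative ?g (at x) h) \<le> sum C Basis * norm h"
          by (simp add: sum_distrib_left mult.commute)
      qed
    qed auto
    then show ?thesis by simp
  qed
  then show ?thesis using C(1) by (blast intro: sum_nonneg)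
qed

text \<open>The gradient is Lipschitz, so on the ball around \<open>z\<close> through
  \<open>y\<close> the differential deviates from that at \<open>z\<close> by at most a multiple of
  the radius; the mean value inequality supplies the second factor.\<close>

lemma schwartz_taylor:
  fixes u :: "'a::euclidean_space \<Rightarrow> real"
  assumes u: "schwartz u"
  obtains D L where "linear D" "0 \<le> L" "\<And>y. \<bar>u y - u z - D (y - z)\<bar> \<le> L * (norm (y - z))\<^sup>2"
proof -
  let ?D = "\<lambda>x. frechet_derivative u (at x)"
  have diff: "u differentiable at x" for x
    using schwartz_differentiable[OF u, of "[]"] by simp
  have "\<forall>b\<in>Basis. \<exists>L\<ge>0. \<forall>x y. \<bar>iter_deriv [b] u y - iter_deriv [b] u x\<bar> \<le> L * norm (y - x)"
    by (intro ballI schwartz_iter_deriv_lipschitz[OF u]) auto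
  then obtain L where L: "\<And>b. b \<in> Basis \<Longrightarrow> 0 \<le> L b"
    "\<And>b x y. b \<in> Basis \<Longrightarrow> \<bar>?D y b - ?D x b\<bar> \<le> L b * norm (y - x)"
    by (simp add: bchoice_iff) metis
  have "\<bar>u y - u z - ?D z (y - z)\<bar> \<le> sum L Basis * (norm (y - z))\<^sup>2" for y
  proof -
    let ?S = "cball z (norm (y - z))"
    have "norm (u y - u z - ?D z (y - z)) \<le> norm (y - z) * (sum L Basis * norm (y - z))"
    proof (rule differentiable_bound_linearization[of _ _ ?S u ?D])
      fix x assume x: "x \<in> ?S"
      show "(u has_derivative ?D x) (at x within ?S)"
        using diff by (simp add: frechet_derivative_works has_derivative_at_withinI)
      show "onorm (?D x - ?D z) \<le> sum L Basis * norm (y - z)"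
      proof (rule onorm_le)
        fix h
        have "(?D x - ?D z) h = (\<Sum>b\<in>Basis. (h \<bullet> b) * (?D x b - ?D z b))"
          by (simp add: frechet_derivative_eq_sum_Basis[OF diff, of _ h] sum_subtractf right_diff_distrib)
        also have "\<bar>\<dots>\<bar> \<le> (\<Sum>b\<in>Basis. \<bar>(h \<bullet> b) * (?D x b - ?D z b)\<bar>)" by (rule sum_abs)
        also have "\<dots> \<le> (\<Sum>b\<in>Basis. norm h * (L b * norm (y - z)))"
          unfolding abs_mult
        proof (intro sum_mono mult_mono Basis_le_norm)
          fix b :: 'a assume b: "b \<in> Basis"
          show "\<bar>?D x b - ?D z b\<bar> \<le> L b * norm (y - z)"
            using L(2)[OF b, of x z] mult_left_mono[OF _ L(1)[OF b], of "norm (x - z)" "norm (y - z)"] x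
            by (simp add: dist_norm norm_minus_commute)
        qed auto
        finally show "norm ((?D x - ?D z) h) \<le> sum L Basis * norm (y - z) * norm h"
          by (simp add: sum_distrib_left sum_distrib_right ac_simps)
      qed
    qed (auto simp: dist_norm mult_left_le_one_le)
    then show ?thesis by (simp add: power2_eq_square ac_simps)
  qed
  moreover have "linear (?D z)" using diff by (rule linear_frechet_derivative)
  ultimately show ?thesis using that L(1) by (blast intro: sum_nonneg)
qed

section \<open>Taylor bounds for \<phi> on the interval\<close>

lemma deriv_in_has_real_derivative:
  assumes "C1_on U f" "x \<in> U"
  shows "(f has_real_derivative deriv_in U f x) (at x within U)"
  using assms unfolding C1_on_def deriv_in_def has_real_derivative_iff_has_vector_derivative
  by (auto simp: differentiable_on_def vector_derivative_works)

text \<open>The bound on the derivative is asked only at points no farther from \<open>a\<close>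
  than \<open>b\<close>. Thus \<open>K\<close> may depend on the distance of \<open>b\<close> from
  \<open>a\<close>, and estimates valid only near \<open>a\<close> can be used.\<close>

lemma interval_mean_value_bound:
  fixes g :: "real \<Rightarrow> real"
  assumes U: "is_interval U" and a: "a \<in> U" and b: "b \<in> U"
    and g: "\<And>x. x \<in> U \<Longrightarrow> (g has_real_derivative g' x) (at x within U)"
    and bd: "\<And>x. x \<in> U \<Longrightarrow> \<bar>x - a\<bar> \<le> \<bar>b - a\<bar> \<Longrightarrow> \<bar>g' x\<bar> \<le> K"
  shows "\<bar>g b - g a\<bar> \<le> K * \<bar>b - a\<bar>"
proof -
  have sub: "closed_segment a b \<subseteq> U"
    using U a b by (simp add: is_interval_convex closed_segment_subset)
  have "norm (g b - g a) \<le> K * norm (b - a)"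
  proof (rule field_differentiable_bound[of "closed_segment a b" g g'])
    fix x assume x: "x \<in> closed_segment a b"
    show "(g has_real_derivative g' x) (at x within closed_segment a b)"
      using g sub x by (blast intro: DERIV_subset)
    have "\<bar>x - a\<bar> \<le> \<bar>b - a\<bar>"
      using x by (auto simp: closed_segment_eq_real_ivl split: if_splits)
    then show "norm (g' x) \<le> K" using bd sub x by auto
  qed auto
  then show ?thesis by simp
qed

text \<open>The mean value bound for \<phi> minus its tangent at \<open>a\<close>. Being valid on
  all of \<open>U\<close>, it makes the first order remainder of \<phi> along \<open>u\<close>
  quadratic in the increment of \<open>u\<close>.\<close>

lemma C11_taylor:
  assumes U: "is_interval U" and phi: "C11_on U \<phi>" and a: "a \<in> U"
  shows "\<exists>L\<ge>0. \<forall>b\<in>U. \<bar>\<phi> b - \<phi> a - deriv_in U \<phi> a * (b - a)\<bar> \<le> L * (b - a)\<^sup>2"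
proof -
  obtain L where L: "L-lipschitz_on U (deriv_in U \<phi>)" and C1: "C1_on U \<phi>"
    using phi by (auto simp: C11_on_def)
  have "\<bar>\<phi> b - \<phi> a - deriv_in U \<phi> a * (b - a)\<bar> \<le> L * (b - a)\<^sup>2" if b: "b \<in> U" for b
  proof -
    let ?g = "\<lambda>x. \<phi> x - deriv_in U \<phi> a * (x - a)"
    have "\<bar>?g b - ?g a\<bar> \<le> (L * \<bar>b - a\<bar>) * \<bar>b - a\<bar>"
    proof (rule interval_mean_value_bound[OF U a b])
      fix x assume x: "x \<in> U"
      show "(?g has_real_derivative deriv_in U \<phi> x - deriv_in U \<phi> a) (at x within U)"
        by (auto intro!: derivative_eq_intros deriv_in_has_real_derivative[OF C1 x])
      assume "\<bar>x - a\<bar> \<le> \<bar>b - a\<bar>"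
      then have "L * \<bar>x - a\<bar> \<le> L * \<bar>b - a\<bar>"
        using lipschitz_on_nonneg[OF L] by (rule mult_left_mono)
      then show "\<bar>deriv_in U \<phi> x - deriv_in U \<phi> a\<bar> \<le> L * \<bar>b - a\<bar>"
        using lipschitz_onD[OF L x a] by (simp add: dist_real_def)
    qed
    then show ?thesis by (simp add: power2_eq_square algebra_simps abs_mult_self_eq flip: abs_mult)
  qed
  then show ?thesis using lipschitz_on_nonneg[OF L] by blast
qed

definition taylor_rem :: "real set \<Rightarrow> (real \<Rightarrow> real) \<Rightarrow> real \<Rightarrow> real \<Rightarrow> real" where
  "taylor_rem U \<phi> a b =
     \<phi> b - \<phi> a - deriv_in U \<phi> a * (b - a) - deriv_in U (deriv_in U \<phi>) a / 2 * (b - a)\<^sup>2"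

text \<open>Near \<open>a\<close> the remainder is small compared with \<open>(b - a)\<^sup>2\<close>; away from \<open>a\<close> the quadratic bound
  coming from the Lipschitz derivative is absorbed by the quartic term.\<close>

lemma taylor_rem_bound:
  assumes U: "is_interval U" and phi: "C11_on U \<phi>" and phi2: "C1_on U (deriv_in U \<phi>)"
    and a: "a \<in> U" and eps: "0 < \<epsilon>"
  shows "\<exists>C\<ge>0. \<forall>b\<in>U. \<bar>taylor_rem U \<phi> a b\<bar> \<le> \<epsilon> * (b - a)\<^sup>2 + C * (b - a) ^ 4"
proof -
  let ?d1 = "deriv_in U \<phi>" and ?d2 = "deriv_in U (deriv_in U \<phi>)"
  have C1: "C1_on U \<phi>" using phi by (auto simp: C11_on_def)
  obtain L where L: "0 \<le> L" "\<And>b. b \<in> U \<Longrightarrow> \<bar>\<phi> b - \<phi> a - ?d1 a * (b - a)\<bar> \<le> L * (b - a)\<^sup>2"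
    using C11_taylor[OF U phi a] by blast
  have "(?d1 has_derivative (*) (?d2 a)) (at a within U)"
    using deriv_in_has_real_derivative[OF phi2 a] by (simp add: has_field_derivative_def)
  then obtain \<delta> where \<delta>: "0 < \<delta>"
    "\<And>x. x \<in> U \<Longrightarrow> \<bar>x - a\<bar> < \<delta> \<Longrightarrow> \<bar>?d1 x - ?d1 a - ?d2 a * (x - a)\<bar> \<le> \<epsilon> * \<bar>x - a\<bar>"
    using eps unfolding has_derivative_within_alt by (metis real_norm_def)
  let ?M = "L + \<bar>?d2 a\<bar> / 2"
  let ?C = "?M / \<delta>\<^sup>2"
  have C0: "0 \<le> ?C" using L(1) by simp
  have "\<bar>taylor_rem U \<phi> a b\<bar> \<le> \<epsilon> * (b - a)\<^sup>2 + ?C * (b - a) ^ 4" if b: "b \<in> U" for b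
  proof (cases "\<bar>b - a\<bar> < \<delta>")
    case True
    let ?g = "\<lambda>x. \<phi> x - ?d1 a * (x - a) - ?d2 a / 2 * (x - a)\<^sup>2"
    have "\<bar>?g b - ?g a\<bar> \<le> (\<epsilon> * \<bar>b - a\<bar>) * \<bar>b - a\<bar>"
    proof (rule interval_mean_value_bound[OF U a b])
      fix x assume x: "x \<in> U"
      show "(?g has_real_derivative ?d1 x - ?d1 a - ?d2 a * (x - a)) (at x within U)"
        by (auto intro!: derivative_eq_intros deriv_in_has_real_derivative[OF C1 x])
      assume xb: "\<bar>x - a\<bar> \<le> \<bar>b - a\<bar>"
      have "\<epsilon> * \<bar>x - a\<bar> \<le> \<epsilon> * \<bar>b - a\<bar>" using xb eps by simp
      then show "\<bar>?d1 x - ?d1 a - ?d2 a * (x - a)\<bar> \<le> \<epsilon> * \<bar>b - a\<bar>"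
        using \<delta>(2)[OF x] xb True by linarith
    qed
    also have "\<dots> = \<epsilon> * (b - a)\<^sup>2" by (simp add: power2_eq_square flip: abs_mult)
    finally have "\<bar>taylor_rem U \<phi> a b\<bar> \<le> \<epsilon> * (b - a)\<^sup>2"
      by (simp add: taylor_rem_def algebra_simps)
    moreover have "0 \<le> ?C * (b - a) ^ 4" using C0 by (intro mult_nonneg_nonneg) auto
    ultimately show ?thesis by linarith
  next
    case False
    then have ge: "\<delta>\<^sup>2 \<le> (b - a)\<^sup>2" using \<delta>(1) False by (intro abs_le_square_iff[THEN iffD1]) auto
    have "\<bar>taylor_rem U \<phi> a b\<bar> \<le> L * (b - a)\<^sup>2 + \<bar>?d2 a / 2 * (b - a)\<^sup>2\<bar>"
      using L(2)[OF b] unfolding taylor_rem_def by linarith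
    also have "\<dots> = ?M * (b - a)\<^sup>2" by (simp add: abs_mult algebra_simps)
    also have "\<dots> = ?C * (\<delta>\<^sup>2 * (b - a)\<^sup>2)" using \<delta>(1) by simp
    also have "\<dots> \<le> ?C * ((b - a)\<^sup>2 * (b - a)\<^sup>2)"
      using C0 ge by (intro mult_left_mono mult_right_mono) auto
    also have "\<dots> = ?C * (b - a) ^ 4" by (simp flip: power_add)
    finally show ?thesis using eps by (simp add: add_increasing)
  qed
  then show ?thesis using C0 by blast
qed

text \<open>On a one-point \<open>U\<close> the values of \<open>deriv_in\<close> are unspecified,
  but then b = a and they are multiplied by 0. Otherwise every point of the interval is a limit
  point, so derivatives within \<open>U\<close> are unique and are those of the polynomial.\<close>

lemma taylor_rem_quadratic:
  assumes U: "is_interval U" and eq: "\<And>x. x \<in> U \<Longrightarrow> \<phi> x = p * x\<^sup>2 + q * x + r"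
    and a: "a \<in> U" and b: "b \<in> U"
  shows "taylor_rem U \<phi> a b = 0"
proof (cases "U = {a}")
  case True
  then show ?thesis using b by (simp add: taylor_rem_def)
next
  case False
  have lim: "at x within U \<noteq> bot" if "x \<in> U" for x
    using connected_imp_perfect[of U x] U that False a
    by (auto simp: is_interval_connected trivial_limit_within)
  have deriv: "deriv_in U f x = d"
    if "x \<in> U" "\<And>y. y \<in> U \<Longrightarrow> f y = g y" "(g has_real_derivative d) (at x)" for f g x d
  proof -
    have "(g has_real_derivative d) (at x within U)"
      using that(3) by (rule has_field_derivative_at_within)
    then have "(f has_vector_derivative d) (at x within U)"
      using that(1,2) has_vector_derivative_transform[of x U f g d]
      by (simp add: has_real_derivative_iff_has_vector_derivative)
    then show ?thesis
      unfolding deriv_in_def by (rule vector_derivative_within[OF lim[OF that(1)]])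
  qed
  have d1: "deriv_in U \<phi> x = 2 * p * x + q" if "x \<in> U" for x
    by (rule deriv[OF that eq]) (auto intro!: derivative_eq_intros)
  have d2: "deriv_in U (deriv_in U \<phi>) a = 2 * p"
    by (rule deriv[OF a d1]) (auto intro!: derivative_eq_intros)
  show ?thesis
    unfolding taylor_rem_def d1[OF a] d2 eq[OF a] eq[OF b]
    by (simp add: power2_eq_square algebra_simps)
qed

section \<open>Small-time estimates for the semigroup\<close>

lemma integrable_std_gauss_weight:
  "integrable lborel (\<lambda>x::'a::euclidean_space. std_gauss x * (1 + norm x) ^ 4)"
proof (rule Bochner_Integration.integrable_bound)
  show "integrable lborel (\<lambda>x::'a. 8 * (std_gauss x + std_gauss x * norm x ^ 4))"
    by (intro integrable_mult_right Bochner_Integration.integrable_add integrable_std_gauss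
        integrable_std_gauss_norm4)
  \<comment> \<open>Convexity of the fourth power: 8 is sharp, with equality at r = 1, whence the
    double root in the factorisation.\<close>
  have conv: "(1 + r) ^ 4 \<le> 8 * (1 + r ^ 4)" for r :: real
  proof -
    have "8 * (1 + r ^ 4) - (1 + r) ^ 4 = (r - 1)\<^sup>2 * (7 * r\<^sup>2 + 10 * r + 7)"
      by (simp add: power4_eq_xxxx power2_eq_square algebra_simps)
    moreover have "7 * r\<^sup>2 + 10 * r + 7 = 5 * (r + 1)\<^sup>2 + 2 * r\<^sup>2 + 2"
      by (simp add: power2_eq_square algebra_simps)
    ultimately show ?thesis by (smt (verit) mult_nonneg_nonneg zero_le_power2)
  qed
  have "std_gauss x * (1 + norm x) ^ 4 \<le> 8 * (std_gauss x + std_gauss x * norm x ^ 4)" for x :: 'a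
  proof -
    from mult_left_mono[OF conv[of "norm x"] std_gauss_nonneg[of x]] show ?thesis
      by (simp only: distrib_left mult_1_right mult.left_commute[of _ 8])
  qed
  then show "AE x::'a in lborel. norm (std_gauss x * (1 + norm x) ^ 4)
      \<le> norm (8 * (std_gauss x + std_gauss x * norm x ^ 4))"
    by (auto simp: abs_mult std_gauss_nonneg intro: order_trans[OF _ abs_ge_self])
qed simp

lemma integral_std_gauss_bound:
  fixes f :: "'a::euclidean_space \<Rightarrow> real"
  assumes [measurable]: "f \<in> borel_measurable borel" and "\<And>x. \<bar>f x\<bar> \<le> K * (1 + norm x) ^ 4"
  shows "integrable lborel (\<lambda>x. std_gauss x * f x)"
    and "\<bar>LINT x|lborel. std_gauss x * f x\<bar> \<le> K * (LINT x|lborel. std_gauss (x::'a) * (1 + norm x) ^ 4)"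
proof -
  let ?g = "\<lambda>x::'a. K * (std_gauss x * (1 + norm x) ^ 4)"
  have g: "integrable lborel ?g" by (intro integrable_mult_right integrable_std_gauss_weight)
  have le: "norm (std_gauss x * f x) \<le> ?g x" for x
    using mult_left_mono[OF assms(2) std_gauss_nonneg[of x], of x]
    by (simp add: abs_mult std_gauss_nonneg ac_simps)
  show f: "integrable lborel (\<lambda>x. std_gauss x * f x)"
    by (rule Bochner_Integration.integrable_bound[OF g])
      (use le in \<open>auto intro!: AE_I2 intro: order_trans[OF _ abs_ge_self]\<close>)
  have "norm (LINT x|lborel. std_gauss x * f x) \<le> (LINT x|lborel. ?g x)"
    by (rule Bochner_Integration.integral_norm_bound_integral[OF f g]) (use le in auto)
  then show "\<bar>LINT x|lborel. std_gauss x * f x\<bar> \<le> K * (LINT x|lborel. std_gauss (x::'a) * (1 + norm x) ^ 4)"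
    by simp
qed

context kolmogorov
begin

lemma
  assumes w [measurable]: "w \<in> borel_measurable borel" and M: "\<And>y. \<bar>w y\<bar> \<le> M"
  shows semigroup_P_converges_bounded: "semigroup_P_converges Q B w z"
    and semigroup_P_bounded: "0 < \<tau> \<Longrightarrow> \<bar>semigroup_P Q B \<tau> w z\<bar> \<le> M"
proof -
  obtain X t where z: "z = (X, t)" by fastforce
  obtain A :: "real \<Rightarrow> real^'n^'n" and m where rep: "\<And>\<tau> w. 0 < \<tau> \<Longrightarrow> w \<in> borel_measurable borel \<Longrightarrow>
       semigroup_P Q B \<tau> w (X, t) = (LINT Z|lborel. std_gauss Z * w (m \<tau> + A \<tau> *v Z, t - \<tau>))"
    and int: "\<And>\<tau> w. 0 < \<tau> \<Longrightarrow> w \<in> borel_measurable borel \<Longrightarrow>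
       integrable lborel (\<lambda>Y. kernel Q B X Y \<tau> * w (Y, t - \<tau>)) \<longleftrightarrow>
       integrable lborel (\<lambda>Z. std_gauss Z * w (m \<tau> + A \<tau> *v Z, t - \<tau>))"
    by (rule gaussian_representation[of X t]) blast
  have [measurable]: "(\<lambda>Z. w (m \<tau> + A \<tau> *v Z, t - \<tau>)) \<in> borel_measurable borel" for \<tau>
    by (rule measurable_compose[OF _ w]) (simp add: borel_prod[symmetric])
  have bd: "integrable lborel (\<lambda>Z. std_gauss Z * w (m \<tau> + A \<tau> *v Z, t - \<tau>))" for \<tau>
    by (rule integrable_std_gauss_bounded[where M = M]) (use M in auto)
  then show "semigroup_P_converges Q B w z"
    unfolding semigroup_P_converges_def z using int[OF _ w] by simp
  assume \<tau>: "0 < \<tau>"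
  have "norm (LINT Z|lborel. std_gauss Z * w (m \<tau> + A \<tau> *v Z, t - \<tau>)) \<le> (LINT Z|lborel. std_gauss (Z::real^'n) * M)"
    by (rule Bochner_Integration.integral_norm_bound_integral[OF bd])
      (auto simp: abs_mult std_gauss_nonneg M integrable_std_gauss intro!: mult_left_mono)
  then show "\<bar>semigroup_P Q B \<tau> w z\<bar> \<le> M"
    unfolding z rep[OF \<tau> w] by (simp add: integral_std_gauss)
qed

lemma semigroup_P_const: "0 < \<tau> \<Longrightarrow> semigroup_P Q B \<tau> (\<lambda>_. c) z = c"
proof -
  assume \<tau>: "0 < \<tau>"
  obtain X t where z: "z = (X, t)" by fastforce
  obtain A :: "real \<Rightarrow> real^'n^'n" and m where rep: "\<And>\<tau> w. 0 < \<tau> \<Longrightarrow> w \<in> borel_measurable borel \<Longrightarrow>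
       semigroup_P Q B \<tau> w (X, t) = (LINT Z|lborel. std_gauss Z * w (m \<tau> + A \<tau> *v Z, t - \<tau>))"
    by (rule gaussian_representation[of X t]) blast
  show ?thesis unfolding z by (subst rep[OF \<tau>]) (simp_all add: integral_std_gauss)
qed

lemma semigroup_P_linear:
  assumes "0 < \<tau>" "semigroup_P_converges Q B v z" "semigroup_P_converges Q B w z"
  shows "semigroup_P Q B \<tau> (\<lambda>y. a * v y + b * w y) z =
    a * semigroup_P Q B \<tau> v z + b * semigroup_P Q B \<tau> w z"
proof -
  obtain X t where z: "z = (X, t)" by fastforce
  have "integrable lborel (\<lambda>Y. kernel Q B X Y \<tau> * v (Y, t - \<tau>))"
    "integrable lborel (\<lambda>Y. kernel Q B X Y \<tau> * w (Y, t - \<tau>))"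
    using assms by (auto simp: semigroup_P_converges_def z)
  then show ?thesis
    unfolding semigroup_P_def z by (simp add: distrib_left mult.left_commute[of _ a] mult.left_commute[of _ b])
qed

text \<open>The order of quantifiers matters: \<open>G\<close> depends on \<open>z\<close> only and
  not on \<open>w\<close>, \<open>E\<close> or \<open>F\<close>, so a small coefficient can be
  chosen after \<open>G\<close> is known. The second claim covers functions with a nonzero
  differential at \<open>z\<close>, for which the moment bound would give only the square root of
  \<tau>.\<close>

lemma semigroup_P_growth:
  "\<exists>G\<ge>0. \<forall>w E F. w \<in> borel_measurable borel \<longrightarrow> 0 \<le> E \<longrightarrow> 0 \<le> F \<longrightarrow>
     (\<forall>y. \<bar>w y\<bar> \<le> E * (norm (y - z))\<^sup>2 + F * norm (y - z) ^ 4) \<longrightarrow>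
     (\<forall>\<tau>\<in>{0<..1}. \<bar>semigroup_P Q B \<tau> w z\<bar> \<le> G * (E * \<tau> + F * \<tau>\<^sup>2))" (is ?growth)
  and semigroup_P_taylor:
  "\<And>w D L. w \<in> borel_measurable borel \<Longrightarrow> linear D \<Longrightarrow> 0 \<le> L \<Longrightarrow> (\<And>y. \<bar>w y\<bar> \<le> M) \<Longrightarrow>
     (\<And>y. \<bar>w y - w z - D (y - z)\<bar> \<le> L * (norm (y - z))\<^sup>2) \<Longrightarrow>
     \<exists>G\<ge>0. \<forall>\<tau>\<in>{0<..1}. \<bar>semigroup_P Q B \<tau> w z - w z\<bar> \<le> G * \<tau>"
proof -
  obtain X t where z: "z = (X, t)" by fastforce
  obtain A :: "real \<Rightarrow> real^'n^'n" and m C where C: "0 \<le> C" and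
    rep: "\<And>\<tau> w. 0 < \<tau> \<Longrightarrow> w \<in> borel_measurable borel \<Longrightarrow>
       semigroup_P Q B \<tau> w (X, t) = (LINT Z|lborel. std_gauss Z * w (m \<tau> + A \<tau> *v Z, t - \<tau>))" and
    m: "\<And>\<tau>. \<tau> \<in> {0<..1} \<Longrightarrow> norm (m \<tau> - X) \<le> C * \<tau>" and
    A: "\<And>\<tau> Z. \<tau> \<in> {0<..1} \<Longrightarrow> norm (A \<tau> *v Z) \<le> C * sqrt \<tau> * norm Z"
    by (rule gaussian_representation[of X t]) blast
  let ?y = "\<lambda>\<tau> Z. (m \<tau> + A \<tau> *v Z, t - \<tau>)"
  define J where "J = (LINT Z|lborel. std_gauss (Z::real^'n) * (1 + norm Z) ^ 4)"
  have J: "0 \<le> J" unfolding J_def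
    by (intro integral_nonneg_AE AE_I2) (auto simp: std_gauss_nonneg)
  have y_meas: "(\<lambda>Z. w (?y \<tau> Z)) \<in> borel_measurable borel"
    if "w \<in> borel_measurable borel" for w :: "(real^'n) \<times> real \<Rightarrow> real" and \<tau>
    by (rule measurable_compose[OF _ that]) (simp add: borel_prod[symmetric])
  have drift: "norm (m \<tau> - X, - \<tau>) \<le> (C + 1) * \<tau>" if "\<tau> \<in> {0<..1}" for \<tau>
    using norm_Pair_le[of "m \<tau> - X" "- \<tau>"] m[OF that] that by (simp add: algebra_simps)
  \<comment> \<open>On (0,1] one has \<tau> \<le> sqrt \<tau>, so the drift and the time shift are
    absorbed in the rate of the diffusion.\<close>
  have dist: "norm (?y \<tau> Z - z) \<le> (C + 1) * sqrt \<tau> * (1 + norm Z)" if \<tau>: "\<tau> \<in> {0<..1}" for \<tau> Z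
  proof -
    have "?y \<tau> Z - z = (m \<tau> - X, - \<tau>) + (A \<tau> *v Z, 0)" by (simp add: z)
    then have "norm (?y \<tau> Z - z) \<le> (C + 1) * \<tau> + C * sqrt \<tau> * norm Z"
      using drift[OF \<tau>] A[OF \<tau>, of Z] norm_triangle_ineq[of "(m \<tau> - X, - \<tau>)" "(A \<tau> *v Z, 0)"]
      by (simp add: norm_Pair)
    also have "\<dots> \<le> (C + 1) * sqrt \<tau> + (C + 1) * sqrt \<tau> * norm Z"
    proof (intro add_mono mult_left_mono mult_right_mono)
      have "sqrt \<tau> * sqrt \<tau> \<le> 1 * sqrt \<tau>" using \<tau> by (intro mult_right_mono) auto
      then show "\<tau> \<le> sqrt \<tau>" using \<tau> by simp
    qed (use C \<tau> in auto)
    finally show ?thesis by (simp add: algebra_simps)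
  qed
  \<comment> \<open>The weight is raised from the second to the fourth power so that the single
    moment \<open>J\<close> serves both estimates.\<close>
  have dist2: "(norm (?y \<tau> Z - z))\<^sup>2 \<le> (C + 1)\<^sup>2 * \<tau> * (1 + norm Z) ^ 4" if \<tau>: "\<tau> \<in> {0<..1}" for \<tau> Z
  proof -
    have "(norm (?y \<tau> Z - z))\<^sup>2 \<le> ((C + 1) * sqrt \<tau> * (1 + norm Z))\<^sup>2"
      using dist[OF \<tau>] by (intro power_mono) auto
    also have "\<dots> = (C + 1)\<^sup>2 * \<tau> * (1 + norm Z)\<^sup>2" using \<tau> by (simp add: power_mult_distrib)
    also have "\<dots> \<le> (C + 1)\<^sup>2 * \<tau> * (1 + norm Z) ^ 4"
      using \<tau> C by (intro mult_left_mono power_increasing) auto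
    finally show ?thesis .
  qed
  have dist4: "norm (?y \<tau> Z - z) ^ 4 \<le> (C + 1) ^ 4 * \<tau>\<^sup>2 * (1 + norm Z) ^ 4" if \<tau>: "\<tau> \<in> {0<..1}" for \<tau> Z
  proof -
    have "norm (?y \<tau> Z - z) ^ 4 \<le> ((C + 1) * sqrt \<tau> * (1 + norm Z)) ^ 4"
      using dist[OF \<tau>] by (intro power_mono) auto
    moreover have "sqrt \<tau> ^ 4 = \<tau>\<^sup>2" using \<tau> power_mult[of "sqrt \<tau>" 2 2] by simp
    ultimately show ?thesis by (simp add: power_mult_distrib)
  qed
  show ?growth
  proof (intro exI[of _ "(C + 1) ^ 4 * J"] conjI allI impI ballI)
    show "0 \<le> (C + 1) ^ 4 * J" using C J by simp
    fix w :: "(real^'n) \<times> real \<Rightarrow> real" and E F \<tau> :: real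
    assume w: "w \<in> borel_measurable borel" and EF: "0 \<le> E" "0 \<le> F" and \<tau>: "\<tau> \<in> {0<..1}"
      and bd: "\<forall>y. \<bar>w y\<bar> \<le> E * (norm (y - z))\<^sup>2 + F * norm (y - z) ^ 4"
    have C24: "(C + 1)\<^sup>2 \<le> (C + 1) ^ 4" using C by (intro power_increasing) auto
    have "\<bar>w (?y \<tau> Z)\<bar> \<le> (C + 1) ^ 4 * (E * \<tau> + F * \<tau>\<^sup>2) * (1 + norm Z) ^ 4" for Z
    proof -
      have "\<bar>w (?y \<tau> Z)\<bar> \<le> E * (norm (?y \<tau> Z - z))\<^sup>2 + F * norm (?y \<tau> Z - z) ^ 4" using bd by blast
      also have "\<dots> \<le> E * ((C + 1) ^ 4 * \<tau> * (1 + norm Z) ^ 4) + F * ((C + 1) ^ 4 * \<tau>\<^sup>2 * (1 + norm Z) ^ 4)"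
        using EF \<tau> C24
        by (intro add_mono mult_left_mono order_trans[OF dist2[OF \<tau>]] dist4[OF \<tau>] mult_right_mono) auto
      finally show ?thesis by (simp add: algebra_simps)
    qed
    from integral_std_gauss_bound(2)[OF y_meas[OF w] this]
    show "\<bar>semigroup_P Q B \<tau> w z\<bar> \<le> (C + 1) ^ 4 * J * (E * \<tau> + F * \<tau>\<^sup>2)"
      using \<tau> unfolding z by (subst rep[OF _ w]) (auto simp: J_def ac_simps)
  qed
  fix w :: "(real^'n) \<times> real \<Rightarrow> real" and D L
  assume w [measurable]: "w \<in> borel_measurable borel" and D: "linear D" and L: "0 \<le> L" and M: "\<And>y. \<bar>w y\<bar> \<le> M"
    and taylor: "\<And>y. \<bar>w y - w z - D (y - z)\<bar> \<le> L * (norm (y - z))\<^sup>2"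
  have bD: "bounded_linear D" using D by (simp add: linear_conv_bounded_linear)
  obtain K where K: "0 \<le> K" "\<And>x. \<bar>D x\<bar> \<le> K * norm x"
    using bounded_linear.nonneg_bounded[OF bD] by (auto simp: mult.commute)
  let ?G = "(K * (C + 1) + L * (C + 1)\<^sup>2) * J"
  have "\<bar>semigroup_P Q B \<tau> w z - w z\<bar> \<le> ?G * \<tau>" if \<tau>: "\<tau> \<in> {0<..1}" for \<tau>
  proof -
    \<comment> \<open>The differential of the increment splits into the deterministic part
      \<open>D (m \<tau> - X, - \<tau>)\<close>, which is O(\<tau>), and this part, which is linear
      in \<open>Z\<close> and has mean zero.\<close>
    let ?D = "\<lambda>Z. D (A \<tau> *v Z, 0)"
    have linD: "linear ?D"
      using linear_compose[OF linear_compose[OF matrix_vector_mul_linear[of "A \<tau>"]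
          bounded_linear.linear[OF bounded_linear_Pair[OF bounded_linear_ident bounded_linear_zero]]] D]
      by (simp add: o_def)
    have meas [measurable]: "?D \<in> borel_measurable borel" "(\<lambda>Z. w (?y \<tau> Z)) \<in> borel_measurable borel"
      using linD y_meas[OF w] by (auto intro!: borel_measurable_continuous_onI linear_continuous_on
          simp: linear_conv_bounded_linear)
    have pw: "\<bar>w (?y \<tau> Z) - w z - ?D Z\<bar> \<le> ((K * (C + 1) + L * (C + 1)\<^sup>2) * \<tau>) * (1 + norm Z) ^ 4" for Z
    proof -
      have "?y \<tau> Z - z = (m \<tau> - X, - \<tau>) + (A \<tau> *v Z, 0)" by (simp add: z)
      then have "D (?y \<tau> Z - z) = D (m \<tau> - X, - \<tau>) + ?D Z"
        by (simp only: linear_add[OF D])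
      then have "\<bar>w (?y \<tau> Z) - w z - ?D Z\<bar> \<le> \<bar>D (m \<tau> - X, - \<tau>)\<bar> + L * (norm (?y \<tau> Z - z))\<^sup>2"
        using taylor[of "?y \<tau> Z"] by linarith
      also have "\<dots> \<le> K * ((C + 1) * \<tau>) * 1 + L * ((C + 1)\<^sup>2 * \<tau> * (1 + norm Z) ^ 4)"
        using K L mult_left_mono[OF drift[OF \<tau>] K(1)] order_trans[OF K(2)[of "(m \<tau> - X, - \<tau>)"]]
        by (intro add_mono mult_left_mono dist2[OF \<tau>]) auto
      also have "\<dots> \<le> K * ((C + 1) * \<tau>) * (1 + norm Z) ^ 4 + L * ((C + 1)\<^sup>2 * \<tau> * (1 + norm Z) ^ 4)"
        using K C \<tau> by (intro add_mono mult_left_mono one_le_power order_refl) auto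
      finally show ?thesis by (simp add: algebra_simps)
    qed
    have int1: "integrable lborel (\<lambda>Z. std_gauss Z * (w (?y \<tau> Z) - w z - ?D Z))"
      by (rule integral_std_gauss_bound(1)[OF _ pw]) measurable
    have int2: "integrable lborel (\<lambda>Z. std_gauss Z * (w (?y \<tau> Z) - w z))"
    proof (rule integrable_std_gauss_bounded)
      show "\<bar>w (?y \<tau> Z) - w z\<bar> \<le> 2 * M" for Z
        using M[of "?y \<tau> Z"] M[of z] by linarith
    qed measurable
    \<comment> \<open>Integrability of the linear part is read off as a difference of two integrable
      functions.\<close>
    have int3: "integrable lborel (\<lambda>Z. std_gauss Z * ?D Z)"
      using Bochner_Integration.integrable_diff[OF int2 int1] by (simp add: algebra_simps)
    have int0: "integrable lborel (\<lambda>Z. std_gauss Z * w (?y \<tau> Z))"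
      by (rule integrable_std_gauss_bounded[OF _ M]) measurable
    have "semigroup_P Q B \<tau> w z = (LINT Z|lborel. std_gauss Z * w (?y \<tau> Z))"
      unfolding z by (rule rep) (use \<tau> in auto)
    then have "semigroup_P Q B \<tau> w z - w z =
        (LINT Z|lborel. std_gauss Z * w (?y \<tau> Z)) - (LINT Z|lborel. std_gauss (Z::real^'n) * w z)
        - (LINT Z|lborel. std_gauss Z * ?D Z)"
      by (simp add: integral_std_gauss integral_std_gauss_odd[OF linD])
    also have "\<dots> = (LINT Z|lborel. std_gauss Z * (w (?y \<tau> Z) - w z - ?D Z))"
      using int0 int3 integrable_std_gauss[where 'a = "real^'n"] by (simp add: right_diff_distrib)
    also have "\<bar>\<dots>\<bar> \<le> ((K * (C + 1) + L * (C + 1)\<^sup>2) * \<tau>) * J"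
      unfolding J_def by (rule integral_std_gauss_bound(2)[OF _ pw]) measurable
    finally show ?thesis by (simp add: ac_simps)
  qed
  moreover have "0 \<le> ?G" using K L C J by simp
  ultimately show "\<exists>G\<ge>0. \<forall>\<tau>\<in>{0<..1}. \<bar>semigroup_P Q B \<tau> w z - w z\<bar> \<le> G * \<tau>" by blast
qed

end

section \<open>Fractional powers\<close>

lemma powr_integral_from_0:
  fixes a :: real
  assumes "a > -1"
  shows "has_bochner_integral lborel (\<lambda>x::real. indicator {0..1} x * x powr a) (1 / (a + 1))"
proof (rule has_bochner_integral_nn_integral)
  show "(\<integral>\<^sup>+x. ennreal (indicator {0..1} x * (x::real) powr a) \<partial>lborel) = ennreal (1 / (a + 1))"
    using has_integral_powr_from_0[OF assms, of 1] by (intro nn_integral_has_integral_lebesgue) auto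
qed (use assms in auto)

lemma powr_integral_to_inf:
  fixes s :: real
  assumes "0 < s"
  shows "has_bochner_integral lborel (\<lambda>x::real. indicator {1..} x * x powr (-1 - s)) (1 / s)"
proof (rule has_bochner_integral_nn_integral)
  show "(\<integral>\<^sup>+x. ennreal (indicator {1..} x * (x::real) powr (-1 - s)) \<partial>lborel) = ennreal (1 / s)"
    using has_integral_powr_to_inf[of "-1 - s" 1] assms by (intro nn_integral_has_integral_lebesgue) auto
qed (use assms in auto)

text \<open>The three terms are the integrals of \<tau>^(-s) and \<tau>^(1-s) over (0,1] and of
  \<tau>^(-1-s) over [1,\<infinity>). The dependence on s is kept explicit because only the first of
  them blows up as s tends to 1.\<close>

lemma frac_integral_bound:
  fixes f :: "real \<Rightarrow> real"
  assumes s: "0 < s" "s < 1"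
    and f: "set_borel_measurable borel {0<..} f"
    and small: "\<And>\<tau>. \<tau> \<in> {0<..1} \<Longrightarrow> \<bar>f \<tau>\<bar> \<le> a * \<tau> + b * \<tau>\<^sup>2"
    and large: "\<And>\<tau>. 0 < \<tau> \<Longrightarrow> \<bar>f \<tau>\<bar> \<le> M"
    and nonneg: "0 \<le> a" "0 \<le> b"
  shows "set_integrable lborel {0<..} (\<lambda>\<tau>. \<tau> powr (-1 - s) * f \<tau>)"
    and "\<bar>LINT \<tau>:{0<..}|lborel. \<tau> powr (-1 - s) * f \<tau>\<bar> \<le> a / (1 - s) + b / (2 - s) + M / s"
proof -
  let ?H = "\<lambda>x::real. a * (indicator {0..1} x * x powr (- s)) + b * (indicator {0..1} x * x powr (1 - s))
      + M * (indicator {1..} x * x powr (-1 - s))"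
  let ?F = "\<lambda>\<tau>. indicator {0<..} \<tau> *\<^sub>R (\<tau> powr (-1 - s) * f \<tau>)"
  have M0: "0 \<le> M" using large[of 1] by linarith
  have "has_bochner_integral lborel ?H (a * (1 / (- s + 1)) + b * (1 / (1 - s + 1)) + M * (1 / s))"
    by (intro has_bochner_integral_add has_bochner_integral_mult_right
        powr_integral_from_0 powr_integral_to_inf) (use s in auto)
  then have H: "integrable lborel ?H" "(LINT x|lborel. ?H x) = a / (1 - s) + b / (2 - s) + M / s"
    by (auto simp: has_bochner_integral_iff)
  have "(\<lambda>\<tau>. \<tau> powr (-1 - s) * (indicator {0<..} \<tau> *\<^sub>R f \<tau>)) \<in> borel_measurable borel"
    using f unfolding set_borel_measurable_def by measurable
  then have F: "?F \<in> borel_measurable lborel" by (simp add: mult.left_commute)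
  have le: "norm (?F \<tau>) \<le> ?H \<tau>" for \<tau>
  proof (cases "0 < \<tau>")
    case True
    have exps: "\<tau> powr (-1 - s) * \<tau> = \<tau> powr (- s)" "\<tau> powr (-1 - s) * \<tau>\<^sup>2 = \<tau> powr (1 - s)"
      using True by (simp_all add: powr_mult_base mult.commute flip: powr_numeral powr_add)
    show ?thesis
    proof (cases "\<tau> \<le> 1")
      case le1: True
      have "\<bar>\<tau> powr (-1 - s) * f \<tau>\<bar> \<le> \<tau> powr (-1 - s) * (a * \<tau> + b * \<tau>\<^sup>2)"
        using small[of \<tau>] True le1 unfolding abs_mult by (intro mult_mono) auto
      also have "\<dots> = a * \<tau> powr (- s) + b * \<tau> powr (1 - s)"
        by (simp add: distrib_left mult.left_commute flip: exps)
      finally have "norm (?F \<tau>) \<le> a * \<tau> powr (- s) + b * \<tau> powr (1 - s)" using True by simp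
      moreover have "0 \<le> M * (indicator {1..} \<tau> * \<tau> powr (-1 - s))" using M0 by simp
      moreover have ind: "indicator {0..1} \<tau> = (1::real)" using True le1 by simp
      ultimately show ?thesis unfolding ind mult_1_left by linarith
    next
      case False
      have "\<bar>\<tau> powr (-1 - s) * f \<tau>\<bar> \<le> \<tau> powr (-1 - s) * M"
        using large[OF True] unfolding abs_mult by (intro mult_mono) auto
      then show ?thesis using False True by (simp add: mult.commute)
    qed
  next
    case False
    then show ?thesis using nonneg M0 by simp
  qed
  show int: "set_integrable lborel {0<..} (\<lambda>\<tau>. \<tau> powr (-1 - s) * f \<tau>)"
    unfolding set_integrable_def
    by (rule Bochner_Integration.integrable_bound[OF H(1) F])
      (use le in \<open>auto intro!: AE_I2 intro: order_trans[OF _ abs_ge_self]\<close>)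
  have "norm (LINT x|lborel. ?F x) \<le> (LINT x|lborel. ?H x)"
    using int le unfolding set_integrable_def
    by (intro Bochner_Integration.integral_norm_bound_integral H(1)) auto
  then show "\<bar>LINT \<tau>:{0<..}|lborel. \<tau> powr (-1 - s) * f \<tau>\<bar> \<le> a / (1 - s) + b / (2 - s) + M / s"
    unfolding H(2) set_lebesgue_integral_def by simp
qed

context kolmogorov
begin

lemma semigroup_P_diff_measurable:
  assumes "w \<in> borel_measurable borel"
  shows "set_borel_measurable borel {0<..} (\<lambda>\<tau>. semigroup_P Q B \<tau> w z - w z)"
proof -
  have "set_borel_measurable borel {0<..} (\<lambda>_::real. w z)"
    unfolding set_borel_measurable_def by measurable
  then show ?thesis
    using semigroup_P_measurable[OF assms, of z] unfolding set_borel_measurable_def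
    by (simp add: right_diff_distrib)
qed

lemma frac_K_converges_bounded:
  assumes s: "0 < s" "s < 1" and w: "w \<in> borel_measurable borel" and M: "\<And>y. \<bar>w y\<bar> \<le> M"
    and G: "0 \<le> G" "\<And>\<tau>. \<tau> \<in> {0<..1} \<Longrightarrow> \<bar>semigroup_P Q B \<tau> w z - w z\<bar> \<le> G * \<tau>"
  shows "frac_K_converges Q B s w z"
proof -
  have "\<bar>semigroup_P Q B \<tau> w z - w z\<bar> \<le> 2 * M" if "0 < \<tau>" for \<tau>
    using semigroup_P_bounded[OF w M that, of z] M[of z] by linarith
  then have "set_integrable lborel {0<..} (\<lambda>\<tau>. \<tau> powr (-1 - s) * (semigroup_P Q B \<tau> w z - w z))"
    using G by (intro frac_integral_bound(1)[OF s semigroup_P_diff_measurable[OF w], of z G 0 "2 * M"]) auto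
  then show ?thesis
    using semigroup_P_converges_bounded[OF w M] by (simp add: frac_K_converges_def)
qed

text \<open>The convergence premises guard against the default value 0 of divergent integrals, which
  is not additive. Convergence is also a conclusion, so that the lemma can be iterated.\<close>

lemma frac_K_linear:
  assumes "frac_K_converges Q B s v z" "frac_K_converges Q B s w z"
  shows "frac_K_converges Q B s (\<lambda>y. a * v y + b * w y) z"
    and "frac_K Q B s (\<lambda>y. a * v y + b * w y) z = a * frac_K Q B s v z + b * frac_K Q B s w z"
proof -
  let ?I = "\<lambda>w \<tau>. \<tau> powr (-1 - s) * (semigroup_P Q B \<tau> w z - w z)"
  have conv: "semigroup_P_converges Q B v z" "semigroup_P_converges Q B w z"
    and int: "set_integrable lborel {0<..} (?I v)" "set_integrable lborel {0<..} (?I w)"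
    using assms by (auto simp: frac_K_converges_def)
  have eq: "?I (\<lambda>y. a * v y + b * w y) \<tau> = a * ?I v \<tau> + b * ?I w \<tau>" if "\<tau> \<in> {0<..}" for \<tau>
    using that by (subst semigroup_P_linear[OF _ conv]) (auto simp: algebra_simps)
  have int': "set_integrable lborel {0<..} (\<lambda>\<tau>. a * ?I v \<tau> + b * ?I w \<tau>)"
    using int by (intro set_integral_add set_integrable_mult_right) auto
  have "semigroup_P_converges Q B (\<lambda>y. a * v y + b * w y) z"
    using conv by (cases z) (auto simp: semigroup_P_converges_def distrib_left mult.left_commute[of _ a]
        mult.left_commute[of _ b])
  moreover have "set_integrable lborel {0<..} (?I (\<lambda>y. a * v y + b * w y))"
    using int' eq by (subst set_integrable_cong[OF refl refl]) auto
  ultimately show "frac_K_converges Q B s (\<lambda>y. a * v y + b * w y) z"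
    by (simp add: frac_K_converges_def)
  have "(LINT \<tau>:{0<..}|lborel. ?I (\<lambda>y. a * v y + b * w y) \<tau>) =
      (LINT \<tau>:{0<..}|lborel. a * ?I v \<tau> + b * ?I w \<tau>)"
    using eq by (intro set_lebesgue_integral_cong) auto
  also have "\<dots> = a * (LINT \<tau>:{0<..}|lborel. ?I v \<tau>) + b * (LINT \<tau>:{0<..}|lborel. ?I w \<tau>)"
    using int by (subst set_integral_add) (auto intro!: set_integrable_mult_right)
  finally show "frac_K Q B s (\<lambda>y. a * v y + b * w y) z = a * frac_K Q B s v z + b * frac_K Q B s w z"
    unfolding frac_K_def by (simp add: algebra_simps)
qed

lemma frac_K_const: "frac_K_converges Q B s (\<lambda>_. c) z" "frac_K Q B s (\<lambda>_. c) z = 0"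
proof -
  have 0: "\<tau> powr (-1 - s) * (semigroup_P Q B \<tau> (\<lambda>_. c) z - c) = 0" if "\<tau> \<in> {0<..}" for \<tau>
    using that semigroup_P_const by simp
  have "set_integrable lborel {0<..} (\<lambda>\<tau>. \<tau> powr (-1 - s) * (semigroup_P Q B \<tau> (\<lambda>_. c) z - c))"
    using 0 by (subst set_integrable_cong[OF refl refl, of _ _ "\<lambda>_. 0"]) (auto simp: set_integrable_def)
  moreover have "semigroup_P_converges Q B (\<lambda>_. c) z"
    by (rule semigroup_P_converges_bounded[of _ "\<bar>c\<bar>"]) auto
  ultimately show "frac_K_converges Q B s (\<lambda>_. c) z" by (simp add: frac_K_converges_def)
  have "(LINT \<tau>:{0<..}|lborel. \<tau> powr (-1 - s) * (semigroup_P Q B \<tau> (\<lambda>_. c) z - c)) = (LINT \<tau>:{0::real<..}|lborel. 0)"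
    using 0 by (intro set_lebesgue_integral_cong) auto
  then show "frac_K Q B s (\<lambda>_. c) z = 0"
    by (simp add: frac_K_def set_lebesgue_integral_def)
qed

text \<open>\<open>(u - u z)\<^sup>2\<close> vanishes at \<open>z\<close>, so the carre du champ is itself a fractional power.\<close>

lemma carre_du_champ_eq_frac_K:
  "carre_du_champ_converges Q B s u z \<longleftrightarrow> frac_K_converges Q B s (\<lambda>y. (u y - u z)\<^sup>2) z"
  "carre_du_champ Q B s u z = - (1 / 2) * frac_K Q B s (\<lambda>y. (u y - u z)\<^sup>2) z"
proof -
  have "1 / \<tau> powr (1 + s) = \<tau> powr (-1 - s)" for \<tau> :: real
    using powr_minus_divide[of \<tau> "1 + s"] by simp
  then show "carre_du_champ_converges Q B s u z \<longleftrightarrow> frac_K_converges Q B s (\<lambda>y. (u y - u z)\<^sup>2) z"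
    "carre_du_champ Q B s u z = - (1 / 2) * frac_K Q B s (\<lambda>y. (u y - u z)\<^sup>2) z"
    by (simp_all add: carre_du_champ_converges_def frac_K_converges_def carre_du_champ_def frac_K_def)
qed

lemma frac_K_tendsto_0:
  assumes w: "w \<in> borel_measurable borel" and M: "\<And>y. \<bar>w y\<bar> \<le> M" and wz: "w z = 0"
    and small: "\<And>\<epsilon>. 0 < \<epsilon> \<Longrightarrow> \<exists>b\<ge>0. \<forall>\<tau>\<in>{0<..1}. \<bar>semigroup_P Q B \<tau> w z\<bar> \<le> \<epsilon> * \<tau> + b * \<tau>\<^sup>2"
  shows "((\<lambda>s. frac_K Q B s w z) \<longlongrightarrow> 0) (at_left 1)"
proof (rule tendstoI)
  fix e :: real assume e: "0 < e"
  obtain b where b: "0 \<le> b" "\<And>\<tau>. \<tau> \<in> {0<..1} \<Longrightarrow> \<bar>semigroup_P Q B \<tau> w z\<bar> \<le> e / 2 * \<tau> + b * \<tau>\<^sup>2"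
    using small[of "e / 2"] e by auto
  \<comment> \<open>This is \<open>frac_integral_bound\<close> with a = e/2, multiplied by
    s/Gamma(1-s) = s(1-s)/Gamma(2-s). The factor 1-s is used up by the first term and survives on
    the other two, so the limit is e/2, strictly below e.\<close>
  let ?bnd = "\<lambda>s::real. (s * (e / 2) + (1 - s) * (s * b / (2 - s) + M)) / Gamma (2 - s)"
  have Gamma_lim: "((\<lambda>s::real. Gamma (2 - s)) \<longlongrightarrow> Gamma (2 - 1)) (at_left 1)"
    by (intro tendsto_Gamma tendsto_intros) (auto elim!: nonpos_Ints_cases)
  have "(?bnd \<longlongrightarrow> (1 * (e / 2) + (1 - 1) * (1 * b / (2 - 1) + M)) / Gamma (2 - 1)) (at_left 1)"
    by (intro tendsto_intros Gamma_lim) auto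
  then have "(?bnd \<longlongrightarrow> e / 2) (at_left 1)" by simp
  then have "eventually (\<lambda>s. ?bnd s < e) (at_left 1)"
    by (rule order_tendstoD) (use e in simp)
  moreover have "eventually (\<lambda>s::real. s \<in> {0<..<1}) (at_left 1)"
    by (rule eventually_at_left_real) simp
  ultimately show "eventually (\<lambda>s. dist (frac_K Q B s w z) 0 < e) (at_left 1)"
  proof eventually_elim
    fix s :: real
    assume lt: "?bnd s < e" and s': "s \<in> {0<..<1}"
    then have s: "0 < s" "s < 1" by auto
    have G: "0 < Gamma (2 - s)" "0 < Gamma (1 - s)" using s by (auto intro!: Gamma_real_pos)
    have G2: "Gamma (2 - s) = (1 - s) * Gamma (1 - s)"
    proof -
      have "1 - s \<notin> \<int>\<^sub>\<le>\<^sub>0" using s nonpos_Ints_nonpos[of "1 - s"] by linarith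
      from Gamma_plus1[OF this] show ?thesis by simp
    qed
    let ?I = "LINT \<tau>:{0<..}|lborel. \<tau> powr (-1 - s) * (semigroup_P Q B \<tau> w z - w z)"
    have I: "\<bar>?I\<bar> \<le> (e / 2) / (1 - s) + b / (2 - s) + M / s"
    proof (rule frac_integral_bound(2)[OF s semigroup_P_diff_measurable[OF w]])
      show "\<bar>semigroup_P Q B \<tau> w z - w z\<bar> \<le> e / 2 * \<tau> + b * \<tau>\<^sup>2" if "\<tau> \<in> {0<..1}" for \<tau>
        using b(2)[OF that] wz by simp
      show "\<bar>semigroup_P Q B \<tau> w z - w z\<bar> \<le> M" if "0 < \<tau>" for \<tau>
        using semigroup_P_bounded[OF w M that, of z] wz by simp
    qed (use e b in auto)
    have "\<bar>frac_K Q B s w z\<bar> = s / Gamma (1 - s) * \<bar>?I\<bar>"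
      using s G by (simp add: frac_K_def abs_mult)
    also have "\<dots> \<le> s / Gamma (1 - s) * ((e / 2) / (1 - s) + b / (2 - s) + M / s)"
      using I s G by (intro mult_left_mono) auto
    also have "\<dots> = ?bnd s"
    proof -
      have alg: "s / g * (x / k + b / p + M / s) = (s * x + k * (s * b / p + M)) / (k * g)"
        if "s \<noteq> 0" "g \<noteq> 0" "k \<noteq> 0" "p \<noteq> 0" for g x k p :: real
        using that by (simp add: field_simps)
      have "Gamma (1 - s) \<noteq> 0" using G(2) by linarith
      then show ?thesis unfolding G2 by (rule alg[rotated]) (use s in auto)
    qed
    finally show "dist (frac_K Q B s w z) 0 < e" using lt by simp
  qed
qed

end

section \<open>The chain rule\<close>

locale kolmogorov_chain = kolmogorov Q B for Q B :: "real ^ 'n ^ 'n" +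
  fixes U :: "real set" and \<phi> :: "real \<Rightarrow> real" and u :: "(real ^ 'n) \<times> real \<Rightarrow> real"
  assumes U: "is_interval U"
    and phi_C11: "C11_on U \<phi>"
    and phi_C2: "C1_on U (deriv_in U \<phi>)"
    and u_schwartz: "schwartz u"
    and u_range: "range u \<subseteq> U"
begin

lemma u_in_U: "u y \<in> U"
  using u_range by auto

lemma continuous_u: "continuous_on S u"
  using schwartz_differentiable[OF u_schwartz, of "[]"]
  by (auto intro!: continuous_at_imp_continuous_on differentiable_imp_continuous_within)

lemma measurable_u [measurable]: "u \<in> borel_measurable borel"
  by (intro borel_measurable_continuous_onI continuous_u)

lemma measurable_phi_u [measurable]: "(\<lambda>y. \<phi> (u y)) \<in> borel_measurable borel"
proof -
  have "continuous_on U \<phi>"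
    using phi_C11 by (auto simp: C11_on_def C1_on_def differentiable_imp_continuous_on)
  then have "continuous_on UNIV (\<lambda>y. \<phi> (u y))"
    by (rule continuous_on_compose2[OF _ continuous_u]) (rule u_range)
  then show ?thesis by (rule borel_measurable_continuous_onI)
qed

lemma u_increment:
  obtains M L where "\<And>y. \<bar>u y\<bar> \<le> M" "\<And>z y. (u y - u z)\<^sup>2 \<le> (2 * M)\<^sup>2" "0 \<le> L"
    "\<And>z y. (u y - u z)\<^sup>2 \<le> L * (norm (y - z))\<^sup>2"
proof -
  obtain M where M: "\<And>y. \<bar>u y\<bar> \<le> M"
    using schwartz_iter_deriv_bounded[OF u_schwartz, of "[]"] by auto
  obtain L where L: "0 \<le> L" "\<And>z y. \<bar>u y - u z\<bar> \<le> L * norm (y - z)"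
    using schwartz_iter_deriv_lipschitz[OF u_schwartz, of "[]"] by auto
  have "(u y - u z)\<^sup>2 \<le> L\<^sup>2 * (norm (y - z))\<^sup>2" for y z
    using power_mono[OF L(2)[of y z] abs_ge_zero, of 2] by (simp add: power_mult_distrib)
  moreover have "(u y - u z)\<^sup>2 \<le> (2 * M)\<^sup>2" for y z
    using M[of y] M[of z] by (intro abs_le_square_iff[THEN iffD1]) linarith
  ultimately show ?thesis by (intro that[of M "L\<^sup>2"] M) auto
qed

text \<open>Such a \<open>w\<close> vanishes at \<open>z\<close> and is dominated by the squared
  distance, so \<open>semigroup_P_growth\<close> with F = 0 controls small times, and boundedness of
  \<open>u\<close> the large ones. It covers the squared increment and the first order remainder of
  \<phi>.\<close>

lemma frac_K_converges_quadratic: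
  assumes s: "0 < s" "s < 1" and w: "w \<in> borel_measurable borel"
    and c: "0 \<le> c" "\<And>y. \<bar>w y\<bar> \<le> c * (u y - u z)\<^sup>2"
  shows "frac_K_converges Q B s w z"
proof -
  obtain M L where M: "\<And>z y. (u y - u z)\<^sup>2 \<le> (2 * M)\<^sup>2" and
    L: "0 \<le> L" "\<And>z y. (u y - u z)\<^sup>2 \<le> L * (norm (y - z))\<^sup>2"
    by (rule u_increment) blast
  obtain G where G: "0 \<le> G" "\<forall>w E F. w \<in> borel_measurable borel \<longrightarrow> 0 \<le> E \<longrightarrow> 0 \<le> F \<longrightarrow>
     (\<forall>y. \<bar>w y\<bar> \<le> E * (norm (y - z))\<^sup>2 + F * norm (y - z) ^ 4) \<longrightarrow>
     (\<forall>\<tau>\<in>{0<..1}. \<bar>semigroup_P Q B \<tau> w z\<bar> \<le> G * (E * \<tau> + F * \<tau>\<^sup>2))"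
    using semigroup_P_growth[of z] by blast
  have wz: "w z = 0" using c(2)[of z] by simp
  have "\<bar>w y\<bar> \<le> (c * L) * (norm (y - z))\<^sup>2 + 0 * norm (y - z) ^ 4" for y
    using order_trans[OF c(2)[of y] mult_left_mono[OF L(2) c(1)]] by (simp add: mult.assoc)
  note P = G(2)[rule_format, OF w _ _ this]
  show ?thesis
  proof (rule frac_K_converges_bounded[OF s w])
    show "\<bar>w y\<bar> \<le> c * (2 * M)\<^sup>2" for y
      using order_trans[OF c(2)[of y] mult_left_mono[OF M c(1)]] .
    show "0 \<le> G * (c * L)" using G(1) c(1) L(1) by simp
    show "\<bar>semigroup_P Q B \<tau> w z - w z\<bar> \<le> G * (c * L) * \<tau>" if "\<tau> \<in> {0<..1}" for \<tau>
      using P[OF _ _ that] c(1) L(1) by (simp add: wz mult.assoc)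
  qed
qed

text \<open>The increment of \<open>u\<close> is in general only of first order at \<open>z\<close>,
  hence the appeal to \<open>semigroup_P_taylor\<close> with its cancellation of the linear
  term.\<close>

lemma frac_K_converges_u:
  assumes s: "0 < s" "s < 1"
  shows "frac_K_converges Q B s u z"
proof -
  obtain M L where M: "\<And>y. \<bar>u y\<bar> \<le> M" by (rule u_increment) blast
  obtain D L where D: "linear D" "0 \<le> L" "\<And>y. \<bar>u y - u z - D (y - z)\<bar> \<le> L * (norm (y - z))\<^sup>2"
    by (rule schwartz_taylor[OF u_schwartz]) blast
  show ?thesis
    using semigroup_P_taylor[OF measurable_u D(1,2) M D(3)]
      frac_K_converges_bounded[OF s measurable_u M] by blast
qed

lemma frac_K_converges_increment_sq:
  assumes s: "0 < s" "s < 1"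
  shows "frac_K_converges Q B s (\<lambda>y. (u y - u z)\<^sup>2) z"
  by (rule frac_K_converges_quadratic[OF s, of _ 1]) auto

abbreviation remainder :: "(real ^ 'n) \<times> real \<Rightarrow> (real ^ 'n) \<times> real \<Rightarrow> real" where
  "remainder z \<equiv> \<lambda>y. taylor_rem U \<phi> (u z) (u y)"

lemma measurable_remainder: "remainder z \<in> borel_measurable borel"
  unfolding taylor_rem_def by measurable

text \<open>Both \<phi> after \<open>u\<close> and its second order remainder are written through
  the first order remainder \<open>?r\<close>: the former adds the affine part \<open>?l\<close>,
  the latter subtracts half the second derivative times the squared increment. All pieces converge,
  and eliminating the fractional power of \<open>?r\<close> gives the identity.\<close>

lemma
  assumes s: "0 < s" "s < 1"
  shows frac_K_converges_phi_u: "frac_K_converges Q B s (\<phi> \<circ> u) z"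
    and frac_K_phi_u: "frac_K Q B s (\<phi> \<circ> u) z =
      deriv_in U \<phi> (u z) * frac_K Q B s u z
      - deriv_in U (deriv_in U \<phi>) (u z) * carre_du_champ Q B s u z
      + frac_K Q B s (remainder z) z"
proof -
  let ?a = "u z"
  let ?d1 = "deriv_in U \<phi> ?a" and ?d2 = "deriv_in U (deriv_in U \<phi>) ?a"
  let ?sq = "\<lambda>y. (u y - ?a)\<^sup>2"
  let ?r = "\<lambda>y. \<phi> (u y) - \<phi> ?a - ?d1 * (u y - ?a)"
  let ?l = "\<lambda>y. ?d1 * u y + (\<phi> ?a - ?d1 * ?a) * 1"
  obtain L where L: "0 \<le> L" "\<And>y. \<bar>?r y\<bar> \<le> L * ?sq y"
    using C11_taylor[OF U phi_C11 u_in_U] u_in_U by blast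
  have r: "frac_K_converges Q B s ?r z"
    by (rule frac_K_converges_quadratic[OF s _ L]) measurable
  note l = frac_K_linear[OF frac_K_converges_u[OF s] frac_K_const(1)[where c = 1], where a = ?d1 and b = "\<phi> ?a - ?d1 * ?a" and z = z]
  \<comment> \<open>The factors 1 here, and the constant function 1 in \<open>?l\<close>, put the
    sums into the shape of \<open>frac_K_linear\<close> and \<open>frac_K_const\<close>.\<close>
  have phi: "\<phi> \<circ> u = (\<lambda>y. 1 * ?r y + 1 * ?l y)"
    by (auto simp: fun_eq_iff algebra_simps)
  show "frac_K_converges Q B s (\<phi> \<circ> u) z"
    unfolding phi by (rule frac_K_linear(1)[OF r l(1)])
  have "frac_K Q B s (\<phi> \<circ> u) z = frac_K Q B s ?r z + ?d1 * frac_K Q B s u z"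
    unfolding phi by (subst frac_K_linear(2)[OF r l(1)]) (simp only: l(2) frac_K_const(2) mult_1 mult_zero_right add_0_right)
  moreover have "remainder z = (\<lambda>y. 1 * ?r y + (- ?d2 / 2) * ?sq y)"
    by (auto simp: fun_eq_iff taylor_rem_def)
  then have "frac_K Q B s (remainder z) z = frac_K Q B s ?r z - ?d2 / 2 * frac_K Q B s ?sq z"
    by (simp only: frac_K_linear(2)[OF r frac_K_converges_increment_sq[OF s]])
  ultimately show "frac_K Q B s (\<phi> \<circ> u) z = ?d1 * frac_K Q B s u z
      - ?d2 * carre_du_champ Q B s u z + frac_K Q B s (remainder z) z"
    by (simp add: carre_du_champ_eq_frac_K(2))
qed

lemma frac_K_remainder_tendsto_0: "((\<lambda>s. frac_K Q B s (remainder z) z) \<longlongrightarrow> 0) (at_left 1)"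
proof -
  let ?d = "\<lambda>y. u y - u z"
  obtain M L where M: "\<And>y. (?d y)\<^sup>2 \<le> (2 * M)\<^sup>2" and
    L: "0 \<le> L" "\<And>y. (?d y)\<^sup>2 \<le> L * (norm (y - z))\<^sup>2"
    by (rule u_increment) blast
  obtain G where G: "0 \<le> G" "\<forall>w E F. w \<in> borel_measurable borel \<longrightarrow> 0 \<le> E \<longrightarrow> 0 \<le> F \<longrightarrow>
     (\<forall>y. \<bar>w y\<bar> \<le> E * (norm (y - z))\<^sup>2 + F * norm (y - z) ^ 4) \<longrightarrow>
     (\<forall>\<tau>\<in>{0<..1}. \<bar>semigroup_P Q B \<tau> w z\<bar> \<le> G * (E * \<tau> + F * \<tau>\<^sup>2))"
    using semigroup_P_growth[of z] by blast
  have d4: "(?d y) ^ 4 = ((?d y)\<^sup>2)\<^sup>2" for y by simp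
  have rem: "\<exists>C\<ge>0. \<forall>y. \<bar>remainder z y\<bar> \<le> \<epsilon> * (?d y)\<^sup>2 + C * (?d y) ^ 4" if "0 < \<epsilon>" for \<epsilon>
    using taylor_rem_bound[OF U phi_C11 phi_C2 u_in_U that, of z] u_in_U by blast
  \<comment> \<open>The choice \<epsilon> = 1 serves only to show that the remainder is bounded, as
    the tail \<tau> \<ge> 1 requires.\<close>
  obtain C where C: "0 \<le> C" "\<And>y. \<bar>remainder z y\<bar> \<le> 1 * (?d y)\<^sup>2 + C * (?d y) ^ 4"
    using rem[of 1] by auto
  show ?thesis
  proof (rule frac_K_tendsto_0[OF measurable_remainder])
    show "\<bar>remainder z y\<bar> \<le> 1 * (2 * M)\<^sup>2 + C * ((2 * M)\<^sup>2)\<^sup>2" for y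
    proof -
      have "((?d y)\<^sup>2)\<^sup>2 \<le> ((2 * M)\<^sup>2)\<^sup>2" by (rule power_mono[OF M]) simp
      then have "1 * (?d y)\<^sup>2 + C * (?d y) ^ 4 \<le> 1 * (2 * M)\<^sup>2 + C * ((2 * M)\<^sup>2)\<^sup>2"
        unfolding d4 by (intro add_mono mult_left_mono M C(1)) auto
      then show ?thesis using C(2)[of y] by linarith
    qed
    show "remainder z z = 0" by (simp add: taylor_rem_def)
    fix \<epsilon> :: real assume \<epsilon>: "0 < \<epsilon>"
    \<comment> \<open>The squared increment is at most L times the squared distance and the
      semigroup costs a factor G, so \<epsilon>' is scaled to make
      \<open>G * (\<epsilon>' * L)\<close> at most \<epsilon>; the added 1 allows G * L = 0.\<close>
    define \<epsilon>' where "\<epsilon>' = \<epsilon> / (G * L + 1)"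
    have GL: "0 \<le> G * L" using G(1) L(1) by simp
    then have \<epsilon>': "0 < \<epsilon>'" using \<epsilon> by (simp add: \<epsilon>'_def)
    have "G * (\<epsilon>' * L) = (G * L) / (G * L + 1) * \<epsilon>" by (simp add: \<epsilon>'_def)
    also have "\<dots> \<le> 1 * \<epsilon>" using GL \<epsilon> by (intro mult_right_mono) auto
    finally have le: "G * (\<epsilon>' * L) \<le> \<epsilon>" by simp
    obtain C where C: "0 \<le> C" "\<And>y. \<bar>remainder z y\<bar> \<le> \<epsilon>' * (?d y)\<^sup>2 + C * (?d y) ^ 4"
      using rem[OF \<epsilon>'] by blast
    have "\<bar>remainder z y\<bar> \<le> (\<epsilon>' * L) * (norm (y - z))\<^sup>2 + (C * L\<^sup>2) * norm (y - z) ^ 4" for y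
    proof -
      have "((?d y)\<^sup>2)\<^sup>2 \<le> (L * (norm (y - z))\<^sup>2)\<^sup>2" by (rule power_mono[OF L(2)]) simp
      then have "\<epsilon>' * (?d y)\<^sup>2 + C * (?d y) ^ 4 \<le> \<epsilon>' * (L * (norm (y - z))\<^sup>2) + C * (L * (norm (y - z))\<^sup>2)\<^sup>2"
        using \<epsilon>' C(1) L(2)[of y] unfolding d4 by (intro add_mono mult_left_mono) auto
      then show ?thesis using C(2)[of y] by (simp add: power_mult_distrib mult.assoc)
    qed
    note P = G(2)[rule_format, OF measurable_remainder _ _ this]
    show "\<exists>b\<ge>0. \<forall>\<tau>\<in>{0<..1}. \<bar>semigroup_P Q B \<tau> (remainder z) z\<bar> \<le> \<epsilon> * \<tau> + b * \<tau>\<^sup>2"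
    proof (intro exI conjI ballI)
      show "0 \<le> G * (C * L\<^sup>2)" using G(1) C(1) by simp
      fix \<tau> :: real assume \<tau>: "\<tau> \<in> {0<..1}"
      have "\<bar>semigroup_P Q B \<tau> (remainder z) z\<bar> \<le> G * (\<epsilon>' * L * \<tau> + C * L\<^sup>2 * \<tau>\<^sup>2)"
        using \<epsilon>' C(1) L(1) by (intro P \<tau>) auto
      also have "\<dots> = G * (\<epsilon>' * L) * \<tau> + G * (C * L\<^sup>2) * \<tau>\<^sup>2" by (simp add: algebra_simps)
      also have "\<dots> \<le> \<epsilon> * \<tau> + G * (C * L\<^sup>2) * \<tau>\<^sup>2"
        using le \<tau> by (intro add_right_mono mult_right_mono) auto
      finally show "\<bar>semigroup_P Q B \<tau> (remainder z) z\<bar> \<le> \<epsilon> * \<tau> + G * (C * L\<^sup>2) * \<tau>\<^sup>2" .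
    qed
  qed
qed

end

theorem proposition1p7:
  fixes Q B :: "real ^ 'n ^ 'n"
    and u :: "(real ^ 'n) \<times> real \<Rightarrow> real"
    and \<phi> :: "real \<Rightarrow> real"
    and U :: "real set"
    and \<alpha> :: real
  assumes N: "CARD('n) \<ge> 2"
    and Q_sym: "transpose Q = Q"
    and Q_nonneg: "\<And>x. 0 \<le> (Q *v x) \<bullet> x"
    and K_invertible: "\<And>t. 0 < t \<Longrightarrow> invertible (Kmat Q B t)"
    and U: "is_interval U"
    and alpha: "0 < \<alpha>"
    and phi_C11: "C11_on U \<phi>"
    and phi_C2: "C2_loc_holder_on \<alpha> U \<phi>"
    and u_schwartz: "schwartz u"
    and u_range: "range u \<subseteq> U"
  shows
    "(\<forall>s\<in>{0<..<1}. \<forall>z. frac_K_converges Q B s u z \<and> frac_K_converges Q B s (\<phi> \<circ> u) z \<and>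
        carre_du_champ_converges Q B s u z) \<and>
     (\<exists>R :: real \<Rightarrow> (real ^ 'n) \<times> real \<Rightarrow> real.
        (\<forall>s\<in>{0<..<1}. \<forall>X t.
           frac_K Q B s (\<phi> \<circ> u) (X, t) =
             deriv_in U \<phi> (u (X, t)) * frac_K Q B s u (X, t)
             - deriv_in U (deriv_in U \<phi>) (u (X, t)) * carre_du_champ Q B s u (X, t)
             + R s (X, t)) \<and>
        (\<forall>X t. ((\<lambda>s. R s (X, t)) \<longlongrightarrow> 0) (at_left 1)) \<and>
        ((\<exists>a b c. \<forall>x\<in>U. \<phi> x = a * x\<^sup>2 + b * x + c) \<longrightarrow>
           (\<forall>s\<in>{0<..<1}. \<forall>X t. R s (X, t) = 0)))"
proof -
  interpret kolmogorov_chain Q B U \<phi> u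
    using assms by unfold_locales (auto simp: C2_loc_holder_on_def)
  show ?thesis
  \<comment> \<open>For s in (0,1) the identity leaves no freedom in the value of \<open>R\<close>;
    the witness exhibits it as a fractional power. The function it is applied to changes with
    \<open>z\<close>, the base point of the expansion.\<close>
  proof (intro conjI exI[of _ "\<lambda>s z. frac_K Q B s (remainder z) z"] ballI allI impI)
    fix s :: real and z :: "(real ^ 'n) \<times> real" assume "s \<in> {0<..<1}"
    then show "frac_K_converges Q B s u z" "frac_K_converges Q B s (\<phi> \<circ> u) z"
      "carre_du_champ_converges Q B s u z"
      by (simp_all add: frac_K_converges_u frac_K_converges_phi_u carre_du_champ_eq_frac_K(1)
          frac_K_converges_increment_sq)
  next
    fix s t :: real and X :: "real ^ 'n" assume "s \<in> {0<..<1}"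
    then show "frac_K Q B s (\<phi> \<circ> u) (X, t) =
        deriv_in U \<phi> (u (X, t)) * frac_K Q B s u (X, t)
        - deriv_in U (deriv_in U \<phi>) (u (X, t)) * carre_du_champ Q B s u (X, t)
        + frac_K Q B s (remainder (X, t)) (X, t)"
      by (intro frac_K_phi_u) auto
  next
    fix s t :: real and X :: "real ^ 'n"
    assume "\<exists>a b c. \<forall>x\<in>U. \<phi> x = a * x\<^sup>2 + b * x + c"
    then have "remainder (X, t) = (\<lambda>_. 0)"
      using taylor_rem_quadratic[OF U] u_in_U by (metis (no_types))
    then show "frac_K Q B s (remainder (X, t)) (X, t) = 0"
      by (simp add: frac_K_const)
  qed (rule frac_K_remainder_tendsto_0)
qed

end
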